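(* Let $f\in\mathcal S_1$ with Stieltjes representation $f=a+S_1[\mu]$, and assume that $\mu$ satisfies one of the following: (i) $\mu$ has a nonzero singular continuous part; (ii) $\mu$ is purely discrete and its set of atoms contains at least two points. Then for each integer $n\ge2$ there exists $\epsilon_n\in(0,1/n)$ such that $f^\alpha\notin\mathcal S_\alpha$ whenever $|\alpha-1/n|<\epsilon_n$. In particular, $f^{1/n}\notin\mathcal S_{1/n}$.
   Context: $\mathbb R_+=[0,\infty)$. For $\alpha\ge0$, $\mathcal M^+_\alpha(\mathbb R_+)$ is the set of positive Borel measures $\mu$ on $\mathbb R_+$ with $\int_{\mathbb R_+}(1+t)^{-\alpha}\mu(dt)<\infty$, and for $\alpha>0$, $S_\alpha[\mu](z)=\int_{\mathbb R_+}\frac{\mu(dt)}{(z+t)^\alpha}$. For $\alpha>0$, $\mathcal S_\alpha$ is the class of functions $f:(0,\infty)\to[0,\infty)$ of the form $f=a+S_\alpha[\mu]$ with $a\ge0$ and $\mu\in\mathcal M^+_\alpha(\mathbb R_+)$; the pair $(a,\mu)$ is uniquely determined by $f$ and called its Stieltjes representation. *)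

theory Defs
  imports "HOL-Analysis.Analysis"
begin

definition measure_on_Rplus :: "real measure \<Rightarrow> bool" where
  "measure_on_Rplus \<mu> \<longleftrightarrow> sets \<mu> = sets borel \<and> emeasure \<mu> {..<0} = 0"

definition M_plus :: "real \<Rightarrow> real measure \<Rightarrow> bool" where
  "M_plus \<alpha> \<mu> \<longleftrightarrow> measure_on_Rplus \<mu> \<and>
     (\<integral>\<^sup>+ t. ennreal ((1 + t) powr (-\<alpha>)) \<partial>\<mu>) < \<infinity>"

definition S_transform :: "real \<Rightarrow> real measure \<Rightarrow> real \<Rightarrow> real" where
  "S_transform \<alpha> \<mu> z = (\<integral> t. (z + t) powr (-\<alpha>) \<partial>\<mu>)"

definition Stieltjes_class :: "real \<Rightarrow> (real \<Rightarrow> real) \<Rightarrow> bool" where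
  "Stieltjes_class \<alpha> f \<longleftrightarrow>
     (\<exists>a \<mu>. a \<ge> 0 \<and> M_plus \<alpha> \<mu> \<and> (\<forall>z>0. f z = a + S_transform \<alpha> \<mu> z))"

definition atoms :: "real measure \<Rightarrow> real set" where
  "atoms \<mu> = {t. emeasure \<mu> {t} > 0}"

definition continuous_part :: "real measure \<Rightarrow> real measure" where
  "continuous_part \<mu> = density \<mu> (indicator (UNIV - atoms \<mu>))"

definition purely_discrete :: "real measure \<Rightarrow> bool" where
  "purely_discrete \<mu> \<longleftrightarrow> emeasure \<mu> (UNIV - atoms \<mu>) = 0"

text \<open>The singular continuous part (the part of the continuous part that is singular
  w.r.t. Lebesgue measure in the Lebesgue decomposition) is nonzero iff the
  continuous part is not absolutely continuous w.r.t. Lebesgue measure.\<close>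
definition nonzero_singular_continuous_part :: "real measure \<Rightarrow> bool" where
  "nonzero_singular_continuous_part \<mu> \<longleftrightarrow>
     \<not> absolutely_continuous lborel (continuous_part \<mu>)"

end

theory Submission
  imports Defs "HOL-Probability.Probability"
begin

text \<open>With \<open>u = 1 / (1 + t)\<close> a function in the Stieltjes class of order \<open>\<alpha>\<close> becomes, after
  normalisation at \<open>1\<close>, the integral of \<open>(1 + x * u) powr (-\<alpha>)\<close> against a probability law on
  \<open>[0, 1]\<close>. By Feynman's parametrisation the product of two such integrals, of orders \<open>\<alpha>\<close> and \<open>\<beta>\<close>
  with laws \<open>\<rho>\<close> and \<open>\<sigma>\<close>, is one of order \<open>\<alpha> + \<beta>\<close>, whose law is that of \<open>w * u + (1 - w) * v\<close> for
  independent \<open>u\<close>, \<open>v\<close> with laws \<open>\<rho>\<close>, \<open>\<sigma>\<close> and a Beta variable \<open>w\<close>. Given \<open>u \<noteq> v\<close> this variable has an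
  absolutely continuous law, so the mixture has no singular continuous part, and two distinct
  atoms force an absolutely continuous part. Writing \<open>f\<close> as the product of \<open>f powr (1 / n)\<close> and
  \<open>f powr ((n - 1) / n)\<close>, and using uniqueness of the law at order \<open>1\<close>, excludes \<open>\<alpha> = 1 / n\<close>. By
  Helly's theorem the orders \<open>\<alpha>\<close> for which \<open>f powr \<alpha>\<close> is representable form a closed set, which
  excludes a neighbourhood as well.\<close>

section \<open>Representing laws on the unit interval\<close>

text \<open>Setwise addition of two measures is countably additive, and the integral identity
  spreads from indicators by induction over measurable functions. It serves to add the atom at
  \<open>0\<close> to the image of \<open>\<mu>\<close> in \<open>compactify\<close>.\<close>

lemma sum_of_measures:
  fixes M N :: "'a measure"
  assumes sets: "sets N = sets M"
  obtains K where "sets K = sets M"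
    and "\<And>g :: 'a \<Rightarrow> ennreal. g \<in> borel_measurable M \<Longrightarrow> (\<integral>\<^sup>+x. g x \<partial>K) = (\<integral>\<^sup>+x. g x \<partial>M) + (\<integral>\<^sup>+x. g x \<partial>N)"
proof
  define K where "K = measure_of (space M) (sets M) (\<lambda>A. emeasure M A + emeasure N A)"
  show sets_K: "sets K = sets M"
    by (simp add: K_def)
  have emeasure_K: "emeasure K A = emeasure M A + emeasure N A" if "A \<in> sets M" for A
    unfolding K_def
  proof (rule emeasure_measure_of_sigma)
    show "sigma_algebra (space M) (sets M)" ..
    show "positive (sets M) (\<lambda>A. emeasure M A + emeasure N A)"
      by (simp add: positive_def)
    show "countably_additive (sets M) (\<lambda>A. emeasure M A + emeasure N A)"
    proof (rule countably_additiveI)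
      fix A :: "nat \<Rightarrow> 'a set"
      assume "range A \<subseteq> sets M" "disjoint_family A" "\<Union> (range A) \<in> sets M"
      then show "(\<Sum>i. emeasure M (A i) + emeasure N (A i)) = emeasure M (\<Union> (range A)) + emeasure N (\<Union> (range A))"
        using sets by (simp add: suminf_add[symmetric] suminf_emeasure)
    qed
  qed (fact that)
  show "(\<integral>\<^sup>+x. g x \<partial>K) = (\<integral>\<^sup>+x. g x \<partial>M) + (\<integral>\<^sup>+x. g x \<partial>N)"
    if "g \<in> borel_measurable M" for g :: "'a \<Rightarrow> ennreal"
    using that
  proof (induction rule: borel_measurable_induct)
    case (cong f g)
    have "space K = space M" "space N = space M"
      using sets sets_K by (auto dest: sets_eq_imp_space_eq)
    then show ?case
      using cong nn_integral_cong[of K f g] nn_integral_cong[of M f g] nn_integral_cong[of N f g] by simp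
  next
    case (set A)
    then show ?case
      using sets sets_K by (simp add: emeasure_K)
  next
    case (mult u c)
    have "u \<in> borel_measurable K" "u \<in> borel_measurable N"
      using mult(2) sets sets_K by (auto cong: measurable_cong_sets)
    then show ?case
      using mult by (simp add: nn_integral_cmult distrib_left)
  next
    case (add u v)
    have "u \<in> borel_measurable K" "u \<in> borel_measurable N" "v \<in> borel_measurable K" "v \<in> borel_measurable N"
      using add sets sets_K by (auto cong: measurable_cong_sets)
    then show ?case
      using add by (simp add: nn_integral_add algebra_simps)
  next
    case (seq U)
    have *: "U i \<in> borel_measurable K" "U i \<in> borel_measurable N" for i
      using seq(1)[of i] sets sets_K by (auto cong: measurable_cong_sets)
    have inc: "incseq (\<lambda>i. \<integral>\<^sup>+x. U i x \<partial>L)" for L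
      using seq by (auto intro!: nn_integral_mono simp: incseq_def le_fun_def)
    have "(\<integral>\<^sup>+x. (SUP i. U i x) \<partial>K) = (SUP i. \<integral>\<^sup>+x. U i x \<partial>K)"
      using seq * by (intro nn_integral_monotone_convergence_SUP) auto
    also have "\<dots> = (SUP i. (\<integral>\<^sup>+x. U i x \<partial>M) + (\<integral>\<^sup>+x. U i x \<partial>N))"
      using seq by simp
    also have "\<dots> = (SUP i. \<integral>\<^sup>+x. U i x \<partial>M) + (SUP i. \<integral>\<^sup>+x. U i x \<partial>N)"
      by (intro ennreal_SUP_add inc)
    also have "\<dots> = (\<integral>\<^sup>+x. (SUP i. U i x) \<partial>M) + (\<integral>\<^sup>+x. (SUP i. U i x) \<partial>N)"
      using seq * by (simp add: nn_integral_monotone_convergence_SUP)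
    finally show ?case
      by (simp add: SUP_apply[abs_def] image_image)
  qed
qed

definition unit_law :: "real measure \<Rightarrow> bool" where
  "unit_law \<rho> \<longleftrightarrow> real_distribution \<rho> \<and> (AE u in \<rho>. u \<in> {0..1})"

text \<open>This is a generalised Stieltjes transform in the bounded variable \<open>u\<close>. At
  \<open>x = 0\<close> the integral is the total mass, so \<open>F 0 = 1\<close> is built in.
  Keeping \<open>x\<close> in \<open>{0..1}\<close> places \<open>1 + x * u\<close> in
  \<open>{1..2}\<close>, where bounds uniform in \<open>u\<close> are at hand, and still determines
  the law at order one.\<close>

definition unit_rep :: "real \<Rightarrow> real measure \<Rightarrow> (real \<Rightarrow> real) \<Rightarrow> bool" where
  "unit_rep \<alpha> \<rho> F \<longleftrightarrow> unit_law \<rho> \<and>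
     (\<forall>x\<in>{0..1}. (\<integral>\<^sup>+u. ennreal ((1 + x * u) powr (-\<alpha>)) \<partial>\<rho>) = ennreal (F x))"

lemma AE_nonneg_M_plus:
  assumes "M_plus \<alpha> \<mu>"
  shows "AE t in \<mu>. 0 \<le> t"
proof -
  have "{..<0} \<in> null_sets \<mu>"
    using assms by (auto simp: M_plus_def measure_on_Rplus_def null_sets_def)
  then show ?thesis
    by (rule AE_I') auto
qed

text \<open>For \<open>z\<close> at least \<open>1\<close> the kernel is dominated by the one at
  \<open>1\<close>, which \<open>M_plus\<close> makes integrable. Hence the Bochner integral in
  \<open>S_transform\<close> is the true integral and not the default value \<open>0\<close> of a
  divergent one.\<close>

lemma nn_integral_S_transform:
  assumes "0 < \<alpha>" "M_plus \<alpha> \<mu>" "1 \<le> z"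
  shows "(\<integral>\<^sup>+t. ennreal ((z + t) powr (-\<alpha>)) \<partial>\<mu>) = ennreal (S_transform \<alpha> \<mu> z)"
proof -
  have [measurable_cong]: "sets \<mu> = sets borel"
    using assms by (auto simp: M_plus_def measure_on_Rplus_def)
  have "(\<integral>\<^sup>+t. ennreal ((z + t) powr (-\<alpha>)) \<partial>\<mu>) \<le> (\<integral>\<^sup>+t. ennreal ((1 + t) powr (-\<alpha>)) \<partial>\<mu>)"
    using AE_nonneg_M_plus[OF assms(2)]
    by (intro nn_integral_mono_AE, eventually_elim)
       (use assms in \<open>auto intro!: ennreal_leI powr_mono2'\<close>)
  also have "\<dots> < \<infinity>"
    using assms by (simp add: M_plus_def)
  finally have "integrable \<mu> (\<lambda>t. (z + t) powr (-\<alpha>))"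
    by (intro integrableI_bounded) simp_all
  then show ?thesis
    unfolding S_transform_def by (intro nn_integral_eq_integral) auto
qed

text \<open>The substitution \<open>u = 1 / (1 + t)\<close> turns \<open>(1 + x + t) powr (-\<alpha>)\<close> into
  \<open>(1 + t) powr (-\<alpha>) * (1 + x * u) powr (-\<alpha>)\<close>; the constant \<open>a\<close> becomes an atom at \<open>u = 0\<close>.\<close>

lemma compactify:
  assumes \<alpha>: "0 < \<alpha>" and a: "0 \<le> a" and \<mu>: "M_plus \<alpha> \<mu>"
    and c: "c = a + S_transform \<alpha> \<mu> 1" "0 < c"
  obtains \<rho> where "unit_rep \<alpha> \<rho> (\<lambda>x. (a + S_transform \<alpha> \<mu> (1 + x)) / c)"
    and "\<And>g :: real \<Rightarrow> ennreal. g \<in> borel_measurable borel \<Longrightarrow>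
      (\<integral>\<^sup>+u. g u \<partial>\<rho>) = (\<integral>\<^sup>+t. ennreal ((1 + t) powr (-\<alpha>) / c) * g (1 / (1 + t)) \<partial>\<mu>) + ennreal (a / c) * g 0"
proof -
  have [measurable_cong]: "sets \<mu> = sets borel"
    using \<mu> by (auto simp: M_plus_def measure_on_Rplus_def)
  define M where "M = distr (density \<mu> (\<lambda>t. ennreal ((1 + t) powr (-\<alpha>) / c))) borel (\<lambda>t. 1 / (1 + t))"
  define N where "N = density (return borel (0::real)) (\<lambda>_. ennreal (a / c))"
  have "sets N = sets M"
    by (simp add: M_def N_def)
  then obtain \<rho> where sets_\<rho>: "sets \<rho> = sets M"
    and add: "\<And>g :: real \<Rightarrow> ennreal. g \<in> borel_measurable M \<Longrightarrow> (\<integral>\<^sup>+x. g x \<partial>\<rho>) = (\<integral>\<^sup>+x. g x \<partial>M) + (\<integral>\<^sup>+x. g x \<partial>N)"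
    by (rule sum_of_measures) blast
  have [measurable_cong, simp]: "sets \<rho> = sets borel"
    using sets_\<rho> by (simp add: M_def)
  have int: "(\<integral>\<^sup>+u. g u \<partial>\<rho>) = (\<integral>\<^sup>+t. ennreal ((1 + t) powr (-\<alpha>) / c) * g (1 / (1 + t)) \<partial>\<mu>) + ennreal (a / c) * g 0"
    if [measurable]: "g \<in> borel_measurable borel" for g :: "real \<Rightarrow> ennreal"
  proof -
    have "(\<integral>\<^sup>+u. g u \<partial>\<rho>) = (\<integral>\<^sup>+x. g x \<partial>M) + (\<integral>\<^sup>+x. g x \<partial>N)"
      by (rule add) (simp add: M_def)
    also have "(\<integral>\<^sup>+x. g x \<partial>M) = (\<integral>\<^sup>+t. ennreal ((1 + t) powr (-\<alpha>) / c) * g (1 / (1 + t)) \<partial>\<mu>)"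
      unfolding M_def by (simp add: nn_integral_distr nn_integral_density)
    also have "(\<integral>\<^sup>+x. g x \<partial>N) = ennreal (a / c) * g 0"
      unfolding N_def by (simp add: nn_integral_density nn_integral_return)
    finally show ?thesis .
  qed
  have S_nonneg: "0 \<le> S_transform \<alpha> \<mu> z" for z
    by (simp add: S_transform_def)
  have rep: "(\<integral>\<^sup>+u. ennreal ((1 + x * u) powr (-\<alpha>)) \<partial>\<rho>) = ennreal ((a + S_transform \<alpha> \<mu> (1 + x)) / c)"
    if x: "x \<in> {0..1}" for x
  proof -
    have "(\<integral>\<^sup>+u. ennreal ((1 + x * u) powr (-\<alpha>)) \<partial>\<rho>) =
      (\<integral>\<^sup>+t. ennreal ((1 + t) powr (-\<alpha>) / c) * ennreal ((1 + x * (1 / (1 + t))) powr (-\<alpha>)) \<partial>\<mu>) + ennreal (a / c)"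
      by (subst int) auto
    also have "(\<integral>\<^sup>+t. ennreal ((1 + t) powr (-\<alpha>) / c) * ennreal ((1 + x * (1 / (1 + t))) powr (-\<alpha>)) \<partial>\<mu>) =
      (\<integral>\<^sup>+t. ennreal (1 / c) * ennreal ((1 + x + t) powr (-\<alpha>)) \<partial>\<mu>)"
      using AE_nonneg_M_plus[OF \<mu>]
    proof (intro nn_integral_cong_AE, eventually_elim)
      fix t :: real assume t: "0 \<le> t"
      have "(1 + t) powr (-\<alpha>) * (1 + x * (1 / (1 + t))) powr (-\<alpha>) = ((1 + t) * (1 + x * (1 / (1 + t)))) powr (-\<alpha>)"
        using t x by (subst powr_mult) (auto simp: field_simps)
      also have "(1 + t) * (1 + x * (1 / (1 + t))) = 1 + x + t"
        using t by (simp add: field_simps)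
      finally show "ennreal ((1 + t) powr (-\<alpha>) / c) * ennreal ((1 + x * (1 / (1 + t))) powr (-\<alpha>)) =
        ennreal (1 / c) * ennreal ((1 + x + t) powr (-\<alpha>))"
        using c(2) by (simp add: ennreal_mult'[symmetric])
    qed
    also have "\<dots> = ennreal (1 / c) * ennreal (S_transform \<alpha> \<mu> (1 + x))"
      using x by (subst nn_integral_cmult) (auto simp: nn_integral_S_transform[OF \<alpha> \<mu>])
    also have "\<dots> + ennreal (a / c) = ennreal ((a + S_transform \<alpha> \<mu> (1 + x)) / c)"
      using c(2) a S_nonneg[of "1 + x"]
      by (simp add: ennreal_mult'[symmetric] ennreal_plus[symmetric] add_divide_distrib add.commute del: ennreal_plus)
    finally show ?thesis .
  qed
  \<comment> \<open>At \<open>x = 0\<close> the kernel is constantly \<open>1\<close>, so the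
    representation computes the total mass; \<open>c\<close> is the value of the function at
    \<open>z = 1\<close> exactly to make it \<open>1\<close>.\<close>
  have "emeasure \<rho> (space \<rho>) = (\<integral>\<^sup>+u. ennreal ((1 + 0 * u) powr (-\<alpha>)) \<partial>\<rho>)"
    by simp
  also have "\<dots> = 1"
    by (subst rep) (use c in auto)
  finally have "prob_space \<rho>"
    by (rule prob_spaceI)
  moreover have "AE u in \<rho>. u \<in> {0..1}"
  proof -
    have "(\<integral>\<^sup>+u. indicator (- {0..1}) u \<partial>\<rho>) = (\<integral>\<^sup>+t. ennreal ((1 + t) powr (-\<alpha>) / c) * indicator (- {0..1}) (1 / (1 + t)) \<partial>\<mu>)"
      by (subst int) auto
    also have "\<dots> = (\<integral>\<^sup>+t. 0 \<partial>\<mu>)"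
      using AE_nonneg_M_plus[OF \<mu>]
      by (intro nn_integral_cong_AE, eventually_elim) (auto simp: indicator_def)
    finally have "emeasure \<rho> (- {0..1}) = 0"
      by simp
    then show ?thesis
      by (intro AE_I[of _ _ "- {0..1}"]) auto
  qed
  ultimately have "unit_law \<rho>"
    by (simp add: unit_law_def real_distribution_def real_distribution_axioms_def)
  with rep int show thesis
    by (intro that[of \<rho>]) (auto simp: unit_rep_def)
qed

section \<open>Products of representations\<close>

definition beta_law :: "real \<Rightarrow> real \<Rightarrow> real measure" where
  "beta_law \<alpha> \<beta> = density lborel
     (\<lambda>w. ennreal (w powr (\<alpha> - 1) * (1 - w) powr (\<beta> - 1) / Beta \<alpha> \<beta>) * indicator {0..1} w)"

lemma sets_beta_law [simp, measurable_cong]: "sets (beta_law \<alpha> \<beta>) = sets borel"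
  by (simp add: beta_law_def)

lemma Beta_real_pos: "0 < \<alpha> \<Longrightarrow> 0 < \<beta> \<Longrightarrow> 0 < Beta \<alpha> (\<beta> :: real)"
  by (simp add: Beta_def Gamma_real_pos)

lemma nn_integral_beta_law:
  assumes [measurable]: "g \<in> borel_measurable borel"
  shows "(\<integral>\<^sup>+w. g w \<partial>beta_law \<alpha> \<beta>) =
    (\<integral>\<^sup>+w. ennreal (w powr (\<alpha> - 1) * (1 - w) powr (\<beta> - 1) / Beta \<alpha> \<beta>) * indicator {0..1} w * g w \<partial>lborel)"
  unfolding beta_law_def by (simp add: nn_integral_density)

lemma nn_integral_beta_density:
  assumes "0 < \<alpha>" "0 < (\<beta> :: real)"
  shows "(\<integral>\<^sup>+w. ennreal (w powr (\<alpha> - 1) * (1 - w) powr (\<beta> - 1) / Beta \<alpha> \<beta>) * indicator {0..1} w \<partial>lborel) = 1"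
proof -
  have "((\<lambda>w. w powr (\<alpha> - 1) * (1 - w) powr (\<beta> - 1) / Beta \<alpha> \<beta>) has_integral (Beta \<alpha> \<beta> / Beta \<alpha> \<beta>)) {0..1}"
    by (intro has_integral_divide has_integral_Beta_real assms)
  then show ?thesis
    using Beta_real_pos[OF assms] by (subst nn_integral_has_integral_lebesgue') auto
qed

lemma AE_beta_law: "AE w in beta_law \<alpha> \<beta>. w \<in> {0..1}"
  unfolding beta_law_def by (subst AE_density) (auto simp: indicator_def)

lemma real_distribution_beta_law:
  assumes "0 < \<alpha>" "0 < \<beta>"
  shows "real_distribution (beta_law \<alpha> \<beta>)"
proof -
  have "emeasure (beta_law \<alpha> \<beta>) (space (beta_law \<alpha> \<beta>)) = (\<integral>\<^sup>+w. 1 \<partial>beta_law \<alpha> \<beta>)"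
    by simp
  also have "\<dots> = 1"
    using nn_integral_beta_density[OF assms] by (subst nn_integral_beta_law) auto
  finally have "prob_space (beta_law \<alpha> \<beta>)"
    by (rule prob_spaceI)
  then show ?thesis
    by (simp add: real_distribution_def real_distribution_axioms_def)
qed

lemma null_sets_beta_law:
  assumes "N \<in> null_sets lborel"
  shows "emeasure (beta_law \<alpha> \<beta>) N = 0"
proof -
  have "absolutely_continuous lborel (beta_law \<alpha> \<beta>)"
    unfolding beta_law_def by (rule absolutely_continuousI_density) measurable
  with assms show ?thesis
    by (auto simp: absolutely_continuous_def)
qed

text \<open>Feynman's parametrisation of \<open>A powr (-\<alpha>) * B powr (-\<beta>)\<close>, via the substitution
  \<open>s = w * A / (w * A + (1 - w) * B)\<close> in the Beta integral.\<close>

lemma nn_integral_Feynman: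
  assumes pos: "0 < \<alpha>" "0 < \<beta>" "0 < A" "0 < (B::real)"
  shows "(\<integral>\<^sup>+w. ennreal ((w * A + (1 - w) * B) powr (-(\<alpha> + \<beta>))) \<partial>beta_law \<alpha> \<beta>) =
    ennreal (A powr (-\<alpha>) * B powr (-\<beta>))"
proof -
  define D where "D w = w * A + (1 - w) * B" for w
  define k where "k s = s powr (\<alpha> - 1) * (1 - s) powr (\<beta> - 1) / Beta \<alpha> \<beta>" for s :: real
  define g where "g w = w * A / D w" for w
  define g' where "g' w = A * B / (D w)\<^sup>2" for w
  have D_pos: "0 < D w" if "w \<in> {0..1}" for w
  proof (cases "w = 0")
    case False
    then have "0 < w * A" "0 \<le> (1 - w) * B"
      using that pos by auto
    then show ?thesis by (simp add: D_def)
  qed (use pos in \<open>simp add: D_def\<close>)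
  have g01: "g 0 = 0" "g 1 = 1"
    using pos by (auto simp: g_def D_def)
  have [measurable]: "k \<in> borel_measurable borel" "D \<in> borel_measurable borel"
    unfolding k_def[abs_def] D_def[abs_def] by measurable
  have sub: "(\<integral>\<^sup>+s. ennreal (k s) * indicator {g 0..g 1} s \<partial>lborel) =
    (\<integral>\<^sup>+w. ennreal (k (g w)) * ennreal (g' w) * indicator {0..1} w \<partial>lborel)"
  proof (rule nn_integral_substitution_aux)
    show "(g has_real_derivative g' w) (at w)" if "w \<in> {0..1}" for w
      unfolding g_def g'_def D_def using D_pos[OF that]
      by (auto intro!: derivative_eq_intros simp: D_def power2_eq_square) (simp add: algebra_simps)
    show "continuous_on {0..1} g'"
      unfolding g'_def D_def using D_pos by (intro continuous_intros) (force simp: D_def)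
  qed (use pos in \<open>auto simp: g'_def\<close>)
  \<comment> \<open>Both \<open>g w\<close> and \<open>1 - g w\<close> have denominator
    \<open>D w\<close>, and \<open>g'\<close> contributes its square, so the exponents of
    \<open>D w\<close> add up to
    \<open>(1 - \<alpha>) + (1 - \<beta>) - 2 = -(\<alpha> + \<beta>)\<close>.\<close>
  have key: "k (g w) * g' w = A powr \<alpha> * B powr \<beta> * (k w * D w powr (-(\<alpha> + \<beta>)))"
    if w: "w \<in> {0..1}" for w
  proof (cases "w = 0 \<or> w = 1")
    \<comment> \<open>At the endpoints the convention \<open>0 powr _ = 0\<close> makes
      \<open>k\<close> vanish, hence both sides.\<close>
    case True
    then show ?thesis using g01 by (auto simp: k_def)
  next
    case False
    then have w: "0 < w" "w < 1"
      using that by auto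
    note D = D_pos[OF that]
    have one_minus: "1 - g w = (1 - w) * B / D w"
      using D by (simp add: g_def field_simps) (simp add: D_def algebra_simps)
    have D_powr: "x / D w powr c = x * D w powr (- c)" for x c
      by (simp add: powr_minus divide_inverse)
    have "g w powr (\<alpha> - 1) = w powr (\<alpha> - 1) * A powr (\<alpha> - 1) * D w powr (1 - \<alpha>)"
      using w pos D D_powr[of _ "\<alpha> - 1"] by (simp add: g_def powr_divide powr_mult)
    moreover have "(1 - g w) powr (\<beta> - 1) = (1 - w) powr (\<beta> - 1) * B powr (\<beta> - 1) * D w powr (1 - \<beta>)"
      using w pos D D_powr[of _ "\<beta> - 1"] by (simp add: one_minus powr_divide powr_mult)
    moreover have "g' w = A powr 1 * B powr 1 * D w powr (-2)"
      using pos D by (simp add: g'_def powr_minus divide_inverse powr_numeral)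
    ultimately have "k (g w) * g' w = w powr (\<alpha> - 1) * (1 - w) powr (\<beta> - 1) / Beta \<alpha> \<beta> *
      (A powr (\<alpha> - 1) * A powr 1) * (B powr (\<beta> - 1) * B powr 1) *
      (D w powr (1 - \<alpha>) * D w powr (1 - \<beta>) * D w powr (-2))"
      by (simp only: k_def) (simp only: divide_inverse mult_ac)
    also have "\<dots> = w powr (\<alpha> - 1) * (1 - w) powr (\<beta> - 1) / Beta \<alpha> \<beta> * A powr \<alpha> * B powr \<beta> * D w powr (-(\<alpha> + \<beta>))"
      by (simp only: powr_add[symmetric]) simp
    finally show ?thesis
      by (simp add: k_def mult_ac)
  qed
  have k_nonneg: "0 \<le> k s" for s
    using Beta_real_pos[OF pos(1,2)] by (simp add: k_def)
  define I where "I = (\<integral>\<^sup>+w. ennreal (D w powr (-(\<alpha> + \<beta>))) \<partial>beta_law \<alpha> \<beta>)"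
  have "1 = (\<integral>\<^sup>+s. ennreal (k s) * indicator {g 0..g 1} s \<partial>lborel)"
    using nn_integral_beta_density[OF pos(1,2)] by (simp add: g01 k_def)
  also have "\<dots> = (\<integral>\<^sup>+w. ennreal (A powr \<alpha> * B powr \<beta>) * (ennreal (k w) * indicator {0..1} w * ennreal (D w powr (-(\<alpha> + \<beta>)))) \<partial>lborel)"
    unfolding sub
  proof (intro nn_integral_cong)
    fix w :: real
    show "ennreal (k (g w)) * ennreal (g' w) * indicator {0..1} w =
      ennreal (A powr \<alpha> * B powr \<beta>) * (ennreal (k w) * indicator {0..1} w * ennreal (D w powr (-(\<alpha> + \<beta>))))"
      using key[of w] k_nonneg by (cases "w \<in> {0..1}") (auto simp: ennreal_mult'[symmetric])
  qed
  also have "\<dots> = ennreal (A powr \<alpha> * B powr \<beta>) * I"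
    unfolding I_def k_def by (subst nn_integral_cmult) (auto simp: nn_integral_beta_law)
  \<comment> \<open>The substituted Beta integral says that
    \<open>A powr \<alpha> * B powr \<beta>\<close> times \<open>I\<close> is \<open>1\<close>;
    multiplying by the reciprocal constant isolates \<open>I\<close>.\<close>
  finally have "ennreal (A powr (-\<alpha>) * B powr (-\<beta>)) = ennreal (A powr (-\<alpha>) * B powr (-\<beta>)) * (ennreal (A powr \<alpha> * B powr \<beta>) * I)"
    by simp
  also have "\<dots> = ennreal (A powr (-\<alpha>) * B powr (-\<beta>)) * ennreal (A powr \<alpha> * B powr \<beta>) * I"
    by (simp only: mult.assoc)
  also have "ennreal (A powr (-\<alpha>) * B powr (-\<beta>)) * ennreal (A powr \<alpha> * B powr \<beta>) =
      ennreal (A powr (-\<alpha>) * B powr (-\<beta>) * (A powr \<alpha> * B powr \<beta>))"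
    by (rule ennreal_mult'[symmetric]) simp
  also have "A powr (-\<alpha>) * B powr (-\<beta>) * (A powr \<alpha> * B powr \<beta>) = 1"
    using pos by (simp add: powr_minus field_simps)
  finally show ?thesis
    by (simp add: I_def D_def)
qed

text \<open>The law of a random convex combination of independent \<open>u\<close> and
  \<open>v\<close>. The factors are nested so that Fubini integrates out the Beta weight
  \<open>w\<close> first, with \<open>u\<close> and \<open>v\<close> fixed.\<close>

definition mix :: "real \<Rightarrow> real \<Rightarrow> real measure \<Rightarrow> real measure \<Rightarrow> real measure" where
  "mix \<alpha> \<beta> \<rho> \<sigma> = distr (\<rho> \<Otimes>\<^sub>M (\<sigma> \<Otimes>\<^sub>M beta_law \<alpha> \<beta>)) borel (\<lambda>(u, v, w). w * u + (1 - w) * v)"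

lemma real_distribution_mix:
  assumes "0 < \<alpha>" "0 < \<beta>" "real_distribution \<rho>" "real_distribution \<sigma>"
  shows "real_distribution (mix \<alpha> \<beta> \<rho> \<sigma>)"
proof -
  interpret r: real_distribution \<rho> by fact
  interpret s: real_distribution \<sigma> by fact
  interpret b: real_distribution "beta_law \<alpha> \<beta>" by (intro real_distribution_beta_law assms)
  interpret sb: pair_prob_space \<sigma> "beta_law \<alpha> \<beta>" ..
  interpret rsb: pair_prob_space \<rho> "\<sigma> \<Otimes>\<^sub>M beta_law \<alpha> \<beta>" ..
  show ?thesis
    unfolding mix_def by (intro rsb.real_distribution_distr) measurable
qed

lemma nn_integral_mix:
  assumes "0 < \<alpha>" "0 < \<beta>" "real_distribution \<rho>" "real_distribution \<sigma>"
    and [measurable]: "g \<in> borel_measurable borel"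
  shows "(\<integral>\<^sup>+y. g y \<partial>mix \<alpha> \<beta> \<rho> \<sigma>) =
    (\<integral>\<^sup>+u. (\<integral>\<^sup>+v. (\<integral>\<^sup>+w. g (w * u + (1 - w) * v) \<partial>beta_law \<alpha> \<beta>) \<partial>\<sigma>) \<partial>\<rho>)"
proof -
  interpret r: real_distribution \<rho> by fact
  interpret s: real_distribution \<sigma> by fact
  interpret b: real_distribution "beta_law \<alpha> \<beta>" by (intro real_distribution_beta_law assms)
  interpret sb: pair_prob_space \<sigma> "beta_law \<alpha> \<beta>" ..
  interpret rsb: pair_prob_space \<rho> "\<sigma> \<Otimes>\<^sub>M beta_law \<alpha> \<beta>" ..
  have "(\<integral>\<^sup>+y. g y \<partial>mix \<alpha> \<beta> \<rho> \<sigma>) = (\<integral>\<^sup>+(u, v, w). g (w * u + (1 - w) * v) \<partial>(\<rho> \<Otimes>\<^sub>M (\<sigma> \<Otimes>\<^sub>M beta_law \<alpha> \<beta>)))"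
    unfolding mix_def by (subst nn_integral_distr) (auto simp: split_beta')
  also have "\<dots> = (\<integral>\<^sup>+u. (\<integral>\<^sup>+p. g (snd p * u + (1 - snd p) * fst p) \<partial>(\<sigma> \<Otimes>\<^sub>M beta_law \<alpha> \<beta>)) \<partial>\<rho>)"
    by (subst sb.nn_integral_fst[symmetric]) (auto simp: split_beta')
  also have "\<dots> = (\<integral>\<^sup>+u. (\<integral>\<^sup>+v. (\<integral>\<^sup>+w. g (w * u + (1 - w) * v) \<partial>beta_law \<alpha> \<beta>) \<partial>\<sigma>) \<partial>\<rho>)"
    by (subst b.nn_integral_fst[symmetric]) auto
  finally show ?thesis .
qed

lemma unit_law_mix:
  assumes ab: "0 < \<alpha>" "0 < \<beta>" and "unit_law \<rho>" "unit_law \<sigma>"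
  shows "unit_law (mix \<alpha> \<beta> \<rho> \<sigma>)"
proof -
  have rd: "real_distribution \<rho>" "real_distribution \<sigma>" and AE: "AE u in \<rho>. u \<in> {0..1}" "AE v in \<sigma>. v \<in> {0..1}"
    using assms by (auto simp: unit_law_def)
  interpret m: real_distribution "mix \<alpha> \<beta> \<rho> \<sigma>"
    by (intro real_distribution_mix ab rd)
  have "(\<integral>\<^sup>+y. indicator (- {0..1}) y \<partial>mix \<alpha> \<beta> \<rho> \<sigma>) =
    (\<integral>\<^sup>+u. (\<integral>\<^sup>+v. (\<integral>\<^sup>+w. indicator (- {0..1}) (w * u + (1 - w) * v) \<partial>beta_law \<alpha> \<beta>) \<partial>\<sigma>) \<partial>\<rho>)"
    by (intro nn_integral_mix ab rd) auto
  also have "\<dots> = (\<integral>\<^sup>+u. (\<integral>\<^sup>+v. (\<integral>\<^sup>+w. 0 \<partial>beta_law \<alpha> \<beta>) \<partial>\<sigma>) \<partial>\<rho>)"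
  proof (rule nn_integral_cong_AE, use AE(1) in eventually_elim, rule nn_integral_cong_AE,
      use AE(2) in eventually_elim, rule nn_integral_cong_AE, use AE_beta_law[of \<alpha> \<beta>] in eventually_elim)
    fix u v w :: real
    assume "u \<in> {0..1}" "v \<in> {0..1}" "w \<in> {0..1}"
    then have "w * u + (1 - w) * v \<in> {0..1}"
      using convexD[of "{0..1::real}" u v w "1 - w"] by auto
    then show "indicator (- {0..1}) (w * u + (1 - w) * v) = (0::ennreal)"
      by (simp del: atLeastAtMost_iff)
  qed
  finally have "emeasure (mix \<alpha> \<beta> \<rho> \<sigma>) (- {0..1}) = 0"
    by simp
  then have "AE u in mix \<alpha> \<beta> \<rho> \<sigma>. u \<in> {0..1}"
    by (intro AE_I[of _ _ "- {0..1}"]) auto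
  with m.real_distribution_axioms show ?thesis
    by (simp add: unit_law_def)
qed

text \<open>Since \<open>1 + x * (w * u + (1 - w) * v)\<close> is the same convex combination of
  \<open>1 + x * u\<close> and \<open>1 + x * v\<close>, Feynman's identity integrates out
  \<open>w\<close> and leaves a product of a function of \<open>u\<close> and one of
  \<open>v\<close>, whose double integral factors.\<close>

lemma unit_rep_mix:
  assumes ab: "0 < \<alpha>" "0 < \<beta>" and rep: "unit_rep \<alpha> \<rho> F" "unit_rep \<beta> \<sigma> G"
    and G: "\<And>x. x \<in> {0..1} \<Longrightarrow> 0 \<le> G x"
  shows "unit_rep (\<alpha> + \<beta>) (mix \<alpha> \<beta> \<rho> \<sigma>) (\<lambda>x. F x * G x)"
proof -
  have law: "unit_law \<rho>" "unit_law \<sigma>"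
    using rep by (auto simp: unit_rep_def)
  then have rd: "real_distribution \<rho>" "real_distribution \<sigma>" and AE: "AE u in \<rho>. u \<in> {0..1}" "AE v in \<sigma>. v \<in> {0..1}"
    by (auto simp: unit_law_def)
  interpret r: real_distribution \<rho> by fact
  interpret s: real_distribution \<sigma> by fact
  have "(\<integral>\<^sup>+y. ennreal ((1 + x * y) powr (-(\<alpha> + \<beta>))) \<partial>mix \<alpha> \<beta> \<rho> \<sigma>) = ennreal (F x * G x)"
    if x: "x \<in> {0..1}" for x
  proof -
    have "(\<integral>\<^sup>+y. ennreal ((1 + x * y) powr (-(\<alpha> + \<beta>))) \<partial>mix \<alpha> \<beta> \<rho> \<sigma>) =
      (\<integral>\<^sup>+u. (\<integral>\<^sup>+v. (\<integral>\<^sup>+w. ennreal ((1 + x * (w * u + (1 - w) * v)) powr (-(\<alpha> + \<beta>))) \<partial>beta_law \<alpha> \<beta>) \<partial>\<sigma>) \<partial>\<rho>)"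
      by (intro nn_integral_mix ab rd) auto
    also have "\<dots> = (\<integral>\<^sup>+u. (\<integral>\<^sup>+v. ennreal ((1 + x * u) powr (-\<alpha>)) * ennreal ((1 + x * v) powr (-\<beta>)) \<partial>\<sigma>) \<partial>\<rho>)"
    proof (rule nn_integral_cong_AE, use AE(1) in eventually_elim, rule nn_integral_cong_AE, use AE(2) in eventually_elim)
      fix u v :: real
      assume "u \<in> {0..1}" "v \<in> {0..1}"
      then have pos: "0 < 1 + x * u" "0 < 1 + x * v"
        using x by (auto intro: add_pos_nonneg)
      have "1 + x * (w * u + (1 - w) * v) = w * (1 + x * u) + (1 - w) * (1 + x * v)" for w
        by (simp add: algebra_simps)
      then show "(\<integral>\<^sup>+w. ennreal ((1 + x * (w * u + (1 - w) * v)) powr (-(\<alpha> + \<beta>))) \<partial>beta_law \<alpha> \<beta>) =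
          ennreal ((1 + x * u) powr (-\<alpha>)) * ennreal ((1 + x * v) powr (-\<beta>))"
        using nn_integral_Feynman[OF ab pos] by (simp add: ennreal_mult')
    qed
    also have "\<dots> = (\<integral>\<^sup>+u. ennreal ((1 + x * u) powr (-\<alpha>)) * ennreal (G x) \<partial>\<rho>)"
      using rep x by (subst nn_integral_cmult) (auto simp: unit_rep_def)
    also have "\<dots> = ennreal (F x) * ennreal (G x)"
      using rep x by (subst nn_integral_multc) (auto simp: unit_rep_def)
    also have "\<dots> = ennreal (F x * G x)"
      using G[OF x] by (simp add: ennreal_mult'')
    finally show ?thesis .
  qed
  then show ?thesis
    using unit_law_mix[OF ab law] by (auto simp: unit_rep_def)
qed

section \<open>Null sets and atoms of the mixture\<close>

lemma emeasure_mix: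
  assumes "0 < \<alpha>" "0 < \<beta>" "real_distribution \<rho>" "real_distribution \<sigma>" and [measurable]: "N \<in> sets borel"
  shows "emeasure (mix \<alpha> \<beta> \<rho> \<sigma>) N =
    (\<integral>\<^sup>+u. (\<integral>\<^sup>+v. emeasure (beta_law \<alpha> \<beta>) {w. w * u + (1 - w) * v \<in> N} \<partial>\<sigma>) \<partial>\<rho>)"
proof -
  have "emeasure (mix \<alpha> \<beta> \<rho> \<sigma>) N = (\<integral>\<^sup>+y. indicator N y \<partial>mix \<alpha> \<beta> \<rho> \<sigma>)"
    by (simp add: mix_def)
  also have "\<dots> = (\<integral>\<^sup>+u. (\<integral>\<^sup>+v. (\<integral>\<^sup>+w. indicator N (w * u + (1 - w) * v) \<partial>beta_law \<alpha> \<beta>) \<partial>\<sigma>) \<partial>\<rho>)"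
    by (intro nn_integral_mix assms) auto
  also have "\<dots> = (\<integral>\<^sup>+u. (\<integral>\<^sup>+v. emeasure (beta_law \<alpha> \<beta>) {w. w * u + (1 - w) * v \<in> N} \<partial>\<sigma>) \<partial>\<rho>)"
  proof (intro nn_integral_cong)
    fix u v :: real
    have [measurable]: "{w. w * u + (1 - w) * v \<in> N} \<in> sets borel"
      by measurable
    have "(\<integral>\<^sup>+w. indicator N (w * u + (1 - w) * v) \<partial>beta_law \<alpha> \<beta>) =
      (\<integral>\<^sup>+w. indicator {w. w * u + (1 - w) * v \<in> N} w \<partial>beta_law \<alpha> \<beta>)"
      by (simp add: indicator_def)
    then show "(\<integral>\<^sup>+w. indicator N (w * u + (1 - w) * v) \<partial>beta_law \<alpha> \<beta>) =
        emeasure (beta_law \<alpha> \<beta>) {w. w * u + (1 - w) * v \<in> N}"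
      by simp
  qed
  finally show ?thesis .
qed

text \<open>For \<open>u \<noteq> v\<close> the map from \<open>w\<close> to the combination is an
  invertible affine map, which pulls Lebesgue null sets back to Lebesgue null sets, and the Beta law
  has a density.\<close>

lemma emeasure_beta_law_affine:
  assumes N: "N \<in> null_sets lborel" and "u \<noteq> (v::real)"
  shows "emeasure (beta_law \<alpha> \<beta>) {w. w * u + (1 - w) * v \<in> N} = 0"
proof (rule null_sets_beta_law)
  have [measurable]: "N \<in> sets borel"
    using N by auto
  have "AE w in lborel. v + (u - v) * w \<notin> N"
    using assms by (intro AE_borel_affine) (auto simp: AE_not_in)
  then have "AE w in lborel. w \<notin> {w. w * u + (1 - w) * v \<in> N}"
    by (simp add: algebra_simps)
  moreover have "{w. w * u + (1 - w) * v \<in> N} \<in> sets lborel"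
    by measurable
  ultimately show "{w. w * u + (1 - w) * v \<in> N} \<in> null_sets lborel"
    by (subst AE_iff_null_sets)
qed

text \<open>Off the diagonal \<open>u = v\<close> the mixture is absolutely continuous; on it, it is a point mass.\<close>

lemma emeasure_mix_null_set:
  assumes ab: "0 < \<alpha>" "0 < \<beta>" and rd: "real_distribution \<rho>" "real_distribution \<sigma>"
    and N: "N \<in> null_sets lborel"
  shows "emeasure (mix \<alpha> \<beta> \<rho> \<sigma>) N = (\<integral>\<^sup>+u. indicator N u * emeasure \<sigma> {u} \<partial>\<rho>)"
proof -
  interpret s: real_distribution \<sigma> by fact
  interpret b: real_distribution "beta_law \<alpha> \<beta>" by (intro real_distribution_beta_law ab)
  have [measurable]: "N \<in> sets borel"
    using N by auto
  have "emeasure (beta_law \<alpha> \<beta>) {w. w * u + (1 - w) * v \<in> N} = indicator N u * indicator {u} v" for u v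
  proof (cases "u = v")
    case True
    have "w * v + (1 - w) * v = v" for w
      by (simp add: algebra_simps)
    then show ?thesis
      using True b.emeasure_space_1 by (cases "v \<in> N") auto
  next
    case False
    then show ?thesis
      using emeasure_beta_law_affine[OF N False] by simp
  qed
  then have "emeasure (mix \<alpha> \<beta> \<rho> \<sigma>) N = (\<integral>\<^sup>+u. (\<integral>\<^sup>+v. indicator N u * indicator {u} v \<partial>\<sigma>) \<partial>\<rho>)"
    by (subst emeasure_mix[OF ab rd]) auto
  also have "\<dots> = (\<integral>\<^sup>+u. indicator N u * emeasure \<sigma> {u} \<partial>\<rho>)"
    by (simp add: nn_integral_cmult)
  finally show ?thesis .
qed

lemma (in real_distribution) countable_atoms: "countable {u. 0 < emeasure M {u}}"
proof -
  have "{u. 0 < emeasure M {u}} = {u. measure M {u} \<noteq> 0}"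
    by (auto simp: emeasure_eq_measure zero_less_measure_iff)
  with countable_support show ?thesis by simp
qed

text \<open>The singleton \<open>{u}\<close> is the section at \<open>u\<close> of the diagonal, a
  measurable subset of the plane, and the measure of a section depends measurably on its base
  point.\<close>

lemma borel_measurable_atom_mass:
  assumes "real_distribution \<sigma>"
  shows "(\<lambda>u. emeasure \<sigma> {u}) \<in> borel_measurable borel"
proof -
  interpret s: real_distribution \<sigma> by fact
  have "Measurable.pred (borel \<Otimes>\<^sub>M borel) (\<lambda>p::real \<times> real. fst p = snd p)"
    by measurable
  then have *: "{p::real \<times> real. fst p = snd p} \<in> sets (borel \<Otimes>\<^sub>M \<sigma>)"
    by (simp add: pred_def space_pair_measure cong: sets_pair_measure_cong)
  have "(\<lambda>u. emeasure \<sigma> (Pair u -` {p::real \<times> real. fst p = snd p})) \<in> borel_measurable borel"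
    by (rule s.measurable_emeasure_Pair[OF *])
  moreover have "Pair u -` {p::real \<times> real. fst p = snd p} = {u}" for u
    by auto
  ultimately show ?thesis by simp
qed

text \<open>A singleton is Lebesgue null, so only the diagonal contributes: the atoms of the mixture
  are the common atoms of its two components.\<close>

lemma atom_mix:
  assumes ab: "0 < \<alpha>" "0 < \<beta>" and rd: "real_distribution \<rho>" "real_distribution \<sigma>"
  shows "emeasure (mix \<alpha> \<beta> \<rho> \<sigma>) {u} = emeasure \<rho> {u} * emeasure \<sigma> {u}"
proof -
  interpret r: real_distribution \<rho> by fact
  have "emeasure (mix \<alpha> \<beta> \<rho> \<sigma>) {u} = (\<integral>\<^sup>+v. indicator {u} v * emeasure \<sigma> {v} \<partial>\<rho>)"
    by (intro emeasure_mix_null_set ab rd) (simp add: countable_imp_null_set_lborel)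
  also have "\<dots> = (\<integral>\<^sup>+v. emeasure \<sigma> {u} * indicator {u} v \<partial>\<rho>)"
    by (intro nn_integral_cong) (auto simp: indicator_def)
  also have "\<dots> = emeasure \<rho> {u} * emeasure \<sigma> {u}"
    by (subst nn_integral_cmult) (auto simp: mult.commute)
  finally show ?thesis .
qed

text \<open>On a Lebesgue null set the mixture integrates the atom masses of \<open>\<sigma>\<close>
  against \<open>\<rho>\<close>. If \<open>N\<close> held no atom of the mixture, each atom of
  \<open>\<sigma>\<close> in \<open>N\<close> would be \<open>\<rho>\<close>-null; there are only
  countably many, so the integral would vanish.\<close>

lemma mix_no_singular_continuous_part:
  assumes ab: "0 < \<alpha>" "0 < \<beta>" and rd: "real_distribution \<rho>" "real_distribution \<sigma>"
    and N: "N \<in> null_sets lborel" "emeasure (mix \<alpha> \<beta> \<rho> \<sigma>) N \<noteq> 0"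
  obtains u where "u \<in> N" "0 < emeasure (mix \<alpha> \<beta> \<rho> \<sigma>) {u}"
proof (rule ccontr)
  interpret r: real_distribution \<rho> by fact
  interpret s: real_distribution \<sigma> by fact
  have [measurable]: "N \<in> sets borel" "(\<lambda>u. emeasure \<sigma> {u}) \<in> borel_measurable borel"
    using N borel_measurable_atom_mass[OF rd(2)] by auto
  define C where "C = N \<inter> {u. 0 < emeasure \<sigma> {u}}"
  assume "\<not> thesis"
  with that have no_atom: "emeasure (mix \<alpha> \<beta> \<rho> \<sigma>) {u} = 0" if "u \<in> N" for u
    using that zero_less_iff_neq_zero by blast
  have "emeasure \<rho> {u} = 0" if "u \<in> C" for u
    using no_atom[of u] that by (auto simp: C_def atom_mix[OF ab rd])
  moreover have "countable C"
    using s.countable_atoms by (auto simp: C_def)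
  ultimately have "C \<in> null_sets \<rho>"
    using null_sets_UN'[of C "\<lambda>u. {u}" \<rho>] by (auto simp: null_sets_def)
  then have "AE u in \<rho>. u \<notin> C"
    by (rule AE_not_in)
  then have "(\<integral>\<^sup>+u. indicator N u * emeasure \<sigma> {u} \<partial>\<rho>) = (\<integral>\<^sup>+u. 0 \<partial>\<rho>)"
    by (intro nn_integral_cong_AE, eventually_elim)
       (auto simp: C_def indicator_def zero_less_iff_neq_zero)
  with N(2) show False
    by (simp add: emeasure_mix_null_set[OF ab rd N(1)])
qed

text \<open>Here \<open>s\<close> is an atom of \<open>\<rho>\<close> and \<open>t\<close> one of
  \<open>\<sigma>\<close>, so the pair \<open>(s, t)\<close> is drawn with positive probability.
  Given that draw, the combination has an absolutely continuous law and almost surely misses the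
  countable set \<open>C\<close>.\<close>

lemma mix_two_atoms:
  assumes ab: "0 < \<alpha>" "0 < \<beta>" and rd: "real_distribution \<rho>" "real_distribution \<sigma>"
    and st: "s \<noteq> t" "0 < emeasure (mix \<alpha> \<beta> \<rho> \<sigma>) {s}" "0 < emeasure (mix \<alpha> \<beta> \<rho> \<sigma>) {t}"
    and C: "countable C"
  shows "0 < emeasure (mix \<alpha> \<beta> \<rho> \<sigma>) (- C)"
proof -
  interpret r: real_distribution \<rho> by fact
  interpret s: real_distribution \<sigma> by fact
  interpret b: real_distribution "beta_law \<alpha> \<beta>" by (intro real_distribution_beta_law ab)
  have C_null: "C \<in> null_sets lborel"
    using C by (rule countable_imp_null_set_lborel)
  then have [measurable]: "C \<in> sets borel"
    by auto
  have "emeasure (beta_law \<alpha> \<beta>) {w. w * s + (1 - w) * t \<in> - C} = 1"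
  proof -
    have [measurable]: "{w. w * s + (1 - w) * t \<in> C} \<in> sets borel"
      by measurable
    have "{w. w * s + (1 - w) * t \<in> - C} = space (beta_law \<alpha> \<beta>) - {w. w * s + (1 - w) * t \<in> C}"
      by auto
    also have "emeasure (beta_law \<alpha> \<beta>) \<dots> = emeasure (beta_law \<alpha> \<beta>) (space (beta_law \<alpha> \<beta>)) - emeasure (beta_law \<alpha> \<beta>) {w. w * s + (1 - w) * t \<in> C}"
      by (intro emeasure_Diff) auto
    also have "\<dots> = 1"
      by (simp only: emeasure_beta_law_affine[OF C_null st(1)] b.emeasure_space_1) simp
    finally show ?thesis .
  qed
  then have le: "indicator {s} u * (indicator {t} v :: ennreal) \<le> emeasure (beta_law \<alpha> \<beta>) {w. w * u + (1 - w) * v \<in> - C}" for u v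
    by (auto simp: indicator_def)
  have "0 < emeasure \<rho> {s} * emeasure \<sigma> {t}"
    using st by (auto simp: atom_mix[OF ab rd] zero_less_iff_neq_zero)
  also have "\<dots> = (\<integral>\<^sup>+u. (\<integral>\<^sup>+v. indicator {s} u * indicator {t} v \<partial>\<sigma>) \<partial>\<rho>)"
    by (simp add: nn_integral_cmult nn_integral_multc)
  also have "\<dots> \<le> (\<integral>\<^sup>+u. (\<integral>\<^sup>+v. emeasure (beta_law \<alpha> \<beta>) {w. w * u + (1 - w) * v \<in> - C} \<partial>\<sigma>) \<partial>\<rho>)"
    by (intro nn_integral_mono le)
  also have "\<dots> = emeasure (mix \<alpha> \<beta> \<rho> \<sigma>) (- C)"
    by (rule emeasure_mix[OF ab rd, symmetric]) measurable
  finally show ?thesis .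
qed

section \<open>Uniqueness at order one\<close>

text \<open>The moments of a law on \<open>[0, 1]\<close> are at most \<open>1\<close>, so the
  Taylor polynomials of the characteristic function, whose coefficients are the moments, converge to
  it everywhere. Levy's uniqueness theorem then applies.\<close>

lemma unit_law_moments_eqI:
  assumes law: "unit_law \<rho>" "unit_law \<tau>"
    and m: "\<And>k. (\<integral>u. u ^ k \<partial>\<rho>) = (\<integral>u. u ^ k \<partial>\<tau>)"
  shows "\<rho> = \<tau>"
proof -
  have conv: "(\<lambda>n. \<Sum>k\<le>n. ((\<i> * t) ^ k / fact k) * complex_of_real (\<integral>u. u ^ k \<partial>\<rho>)) \<longlonglongrightarrow> char \<rho> t"
    if "unit_law \<rho>" for \<rho> t
  proof -
    interpret real_distribution \<rho>
      using that by (simp add: unit_law_def)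
    have AE: "AE u in \<rho>. u \<in> {0..1}"
      using that by (simp add: unit_law_def)
    have le_1: "AE u in \<rho>. \<bar>u ^ k\<bar> \<le> 1" for k
      using AE by eventually_elim (auto simp: power_le_one)
    then have int: "integrable \<rho> (\<lambda>u. u ^ k)" for k
      by (intro integrable_const_bound[where B=1]) auto
    have bound: "expectation (\<lambda>u. \<bar>u\<bar> ^ n) \<le> 1" for n
    proof -
      have "expectation (\<lambda>u. \<bar>u\<bar> ^ n) \<le> expectation (\<lambda>u. 1)"
        using le_1[of n] integrable_abs[OF int[of n]] by (intro integral_mono_AE) (auto simp: power_abs)
      then show ?thesis using prob_space by simp
    qed
    have "(\<lambda>n. (2 * \<bar>t\<bar> ^ n / fact n)) \<longlonglongrightarrow> 2 * 0"
      using tendsto_mult[OF tendsto_const[of "2::real"] summable_LIMSEQ_zero[OF summable_exp[of "\<bar>t\<bar>"]]]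
      by (simp add: divide_inverse mult_ac)
    then have lim: "(\<lambda>n. (2 * \<bar>t\<bar> ^ n / fact n)) \<longlonglongrightarrow> 0"
      by simp
    have "cmod ((\<Sum>k\<le>n. ((\<i> * t) ^ k / fact k) * expectation (\<lambda>u. u ^ k)) - char \<rho> t) \<le> 2 * \<bar>t\<bar> ^ n / fact n" for n
    proof -
      have "cmod ((\<Sum>k\<le>n. ((\<i> * t) ^ k / fact k) * expectation (\<lambda>u. u ^ k)) - char \<rho> t) \<le>
        (2 * \<bar>t\<bar> ^ n / fact n) * expectation (\<lambda>u. \<bar>u\<bar> ^ n)"
        using char_approx1[of n t] int by (simp add: norm_minus_commute)
      also have "\<dots> \<le> (2 * \<bar>t\<bar> ^ n / fact n) * 1"
        by (intro mult_left_mono bound) auto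
      finally show ?thesis by simp
    qed
    then have "(\<lambda>n. (\<Sum>k\<le>n. ((\<i> * t) ^ k / fact k) * complex_of_real (expectation (\<lambda>u. u ^ k))) - char \<rho> t) \<longlonglongrightarrow> 0"
      by (intro Lim_null_comparison[OF _ lim] always_eventually) auto
    then show ?thesis
      by (rule LIM_zero_cancel)
  qed
  have "char \<rho> t = char \<tau> t" for t
    using conv[OF law(1), of t] conv[OF law(2), of t] unfolding m by (rule LIMSEQ_unique)
  then show ?thesis
    using law by (intro Levy_uniqueness) (auto simp: unit_law_def)
qed

text \<open>Below, \<open>D M k x\<close> satisfies \<open>D M k x = m k - x * D M (k + 1) x\<close> with \<open>m k\<close> the moments, so that
  \<open>D M k\<close> determines \<open>m k\<close> as its limit at \<open>0\<close>, and then \<open>D M (k + 1)\<close>.\<close>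

lemma unit_rep_unique:
  assumes rep: "unit_rep 1 \<rho> F" "unit_rep 1 \<tau> F"
  shows "\<rho> = \<tau>"
proof (rule unit_law_moments_eqI)
  show law: "unit_law \<rho>" "unit_law \<tau>"
    using rep by (auto simp: unit_rep_def)
  define D where "D M k x = (\<integral>u. u ^ k / (1 + x * u) \<partial>M)" for M k and x :: real
  have int: "integrable M (\<lambda>u. u ^ k / (1 + x * u))" "integrable M (\<lambda>u. u ^ k)" and D_bound: "\<bar>D M k x\<bar> \<le> 1"
    if "unit_law M" and x: "x \<in> {0..1}" for M k x
  proof -
    interpret real_distribution M
      using that by (simp add: unit_law_def)
    have AE: "AE u in M. u \<in> {0..1}"
      using that by (simp add: unit_law_def)
    have "\<bar>u ^ k / (1 + x * u)\<bar> \<le> 1" if "u \<in> {0..1}" for u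
      using that x frac_le[of 1 "u ^ k" 1 "1 + x * u"] by (auto simp: power_le_one)
    then have le: "AE u in M. norm (u ^ k / (1 + x * u)) \<le> 1"
      by (intro eventually_mono[OF AE]) auto
    show i: "integrable M (\<lambda>u. u ^ k / (1 + x * u))"
      using le by (intro integrable_const_bound) auto
    show "integrable M (\<lambda>u. u ^ k)"
    proof (rule integrable_const_bound[where B=1])
      show "AE u in M. norm (u ^ k) \<le> 1"
        using AE by eventually_elim (auto simp: power_le_one)
    qed simp
    have "\<bar>D M k x\<bar> \<le> (\<integral>u. norm (u ^ k / (1 + x * u)) \<partial>M)"
      unfolding D_def using integral_norm_bound[of M "\<lambda>u. u ^ k / (1 + x * u)"] by simp
    also have "\<dots> \<le> (\<integral>u. 1 \<partial>M)"
      using le integrable_norm[OF i] by (intro integral_mono_AE) auto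
    finally show "\<bar>D M k x\<bar> \<le> 1"
      using prob_space by simp
  qed
  have rec: "D M k x = (\<integral>u. u ^ k \<partial>M) - x * D M (Suc k) x" if "unit_law M" and x: "x \<in> {0..1}" for M k x
  proof -
    interpret real_distribution M
      using that by (simp add: unit_law_def)
    have "D M k x = (\<integral>u. u ^ k - x * (u ^ Suc k / (1 + x * u)) \<partial>M)"
      unfolding D_def
    proof (intro integral_cong_AE)
      have "AE u in M. u \<in> {0..1}"
        using that by (simp add: unit_law_def)
      then show "AE u in M. u ^ k / (1 + x * u) = u ^ k - x * (u ^ Suc k / (1 + x * u))"
      proof eventually_elim
        case (elim u)
        then have "0 < 1 + x * u"
          using x by (auto intro: add_pos_nonneg)
        then show ?case by (simp add: field_simps)
      qed
    qed measurable
    also have "\<dots> = (\<integral>u. u ^ k \<partial>M) - x * D M (Suc k) x"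
    proof -
      have "integrable M (\<lambda>u. x * (u ^ Suc k / (1 + x * u)))"
        by (intro integrable_mult_right int[OF that])
      from Bochner_Integration.integral_diff[OF int(2)[OF that] this] show ?thesis
        by (simp only: D_def integral_mult_right_zero)
    qed
    finally show ?thesis .
  qed
  have lim: "(D M k \<longlongrightarrow> (\<integral>u. u ^ k \<partial>M)) (at_right 0)" if "unit_law M" for M k
  proof -
    have "eventually (\<lambda>x. x \<in> {0..1}) (at_right (0::real))"
      using eventually_at_right_real[of 0 1] by (auto elim!: eventually_mono)
    then have "eventually (\<lambda>x. norm (D M k x - (\<integral>u. u ^ k \<partial>M)) \<le> x) (at_right 0)"
    proof eventually_elim
      case (elim x)
      then show ?case
        using rec[OF that elim, of k] D_bound[OF that elim, of "Suc k"]
        by (simp add: abs_mult mult_left_le)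
    qed
    moreover have "((\<lambda>x::real. x) \<longlongrightarrow> 0) (at_right 0)"
      by (rule tendsto_ident_at)
    ultimately show ?thesis
      by (rule LIM_zero_cancel[OF Lim_null_comparison])
  qed
  have D_eq: "\<forall>x. 0 < x \<and> x \<le> 1 \<longrightarrow> D \<rho> k x = D \<tau> k x"
    and m_eq: "(\<integral>u. u ^ k \<partial>\<rho>) = (\<integral>u. u ^ k \<partial>\<tau>)" for k
  proof -
    have m: "(\<integral>u. u ^ k \<partial>\<rho>) = (\<integral>u. u ^ k \<partial>\<tau>)" if "\<forall>x. 0 < x \<and> x \<le> 1 \<longrightarrow> D \<rho> k x = D \<tau> k x" for k
    proof -
      have "eventually (\<lambda>x. D \<rho> k x = D \<tau> k x) (at_right 0)"
        using eventually_at_right_real[OF zero_less_one] by eventually_elim (use that in auto)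
      then have "(D \<tau> k \<longlongrightarrow> (\<integral>u. u ^ k \<partial>\<rho>)) (at_right 0)"
        using lim[OF law(1)] by (rule Lim_transform_eventually[rotated])
      with lim[OF law(2)] show ?thesis
        by (intro tendsto_unique[of "at_right (0::real)"]) auto
    qed
    show D: "\<forall>x. 0 < x \<and> x \<le> 1 \<longrightarrow> D \<rho> k x = D \<tau> k x"
    proof (induction k)
      case 0
      \<comment> \<open>\<open>D M 0\<close> is the represented function itself; reading it off
        through \<open>enn2real\<close> gives one expression in \<open>F\<close> that is shared by
        both laws.\<close>
      have "D M 0 x = enn2real (ennreal (F x))" if "unit_rep 1 M F" "0 < x" "x \<le> 1" for M x
      proof -
        have AE: "AE u in M. u \<in> {0..1}" and uM: "unit_law M"
          using that by (auto simp: unit_law_def unit_rep_def)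
        have nonneg: "AE u in M. 0 \<le> u ^ 0 / (1 + x * u)"
          using AE by eventually_elim (use that in auto)
        have "ennreal (F x) = (\<integral>\<^sup>+u. ennreal ((1 + x * u) powr (-1)) \<partial>M)"
          using that by (simp add: unit_rep_def)
        also have "\<dots> = (\<integral>\<^sup>+u. ennreal (u ^ 0 / (1 + x * u)) \<partial>M)"
          using AE
        proof (intro nn_integral_cong_AE, eventually_elim)
          fix u :: real assume "u \<in> {0..1}"
          then have "0 < 1 + x * u"
            using that by (auto intro: add_pos_nonneg)
          then show "ennreal ((1 + x * u) powr (-1)) = ennreal (u ^ 0 / (1 + x * u))"
            by (simp add: powr_minus_divide)
        qed
        also have "\<dots> = ennreal (D M 0 x)"
          unfolding D_def using int(1)[OF uM, of x 0] nonneg that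
          by (intro nn_integral_eq_integral) auto
        finally show ?thesis
          using nonneg by (simp add: D_def integral_nonneg_AE)
      qed
      then show ?case
        using rep by simp
    next
      case (Suc k)
      show ?case
      proof (intro allI impI)
        fix x :: real assume x: "0 < x \<and> x \<le> 1"
        then have "x * D \<rho> (Suc k) x = x * D \<tau> (Suc k) x"
          using rec[OF law(1), of x k] rec[OF law(2), of x k] Suc m[OF Suc] by auto
        with x show "D \<rho> (Suc k) x = D \<tau> (Suc k) x"
          by simp
      qed
    qed
    show "(\<integral>u. u ^ k \<partial>\<rho>) = (\<integral>u. u ^ k \<partial>\<tau>)"
      by (rule m[OF D])
  qed
  show "(\<integral>u. u ^ k \<partial>\<rho>) = (\<integral>u. u ^ k \<partial>\<tau>)" for k
    by (rule m_eq)
qed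

section \<open>Limits and powers of representations\<close>

text \<open>The derivative in the exponent is governed by \<open>ln y\<close>, which lies between
  \<open>0\<close> and \<open>1\<close> on \<open>{1..2}\<close>, the range of
  \<open>1 + x * u\<close>. The Lipschitz bound is uniform in \<open>y\<close>, so orders can be
  varied under the integral.\<close>

lemma abs_powr_diff_le:
  assumes "y \<in> {1..2}" "0 \<le> \<alpha>" "0 \<le> (\<beta>::real)"
  shows "\<bar>y powr (-\<alpha>) - y powr (-\<beta>)\<bar> \<le> \<bar>\<alpha> - \<beta>\<bar>"
proof -
  have aux: "\<bar>y powr (-\<alpha>) - y powr (-\<beta>)\<bar> \<le> \<beta> - \<alpha>" if "0 \<le> \<alpha>" "\<alpha> \<le> \<beta>" for \<alpha> \<beta>
  proof -
    have ln: "0 \<le> ln y" "ln y \<le> 1"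
      using assms ln_le_minus_one[of y] by auto
    have "1 - y powr (-(\<beta> - \<alpha>)) \<le> (\<beta> - \<alpha>) * ln y"
      using exp_ge_add_one_self[of "- ((\<beta> - \<alpha>) * ln y)"] assms by (simp add: powr_def algebra_simps)
    also have "\<dots> \<le> \<beta> - \<alpha>"
      using that ln by (simp add: mult_left_le)
    finally have 1: "1 - y powr (-(\<beta> - \<alpha>)) \<le> \<beta> - \<alpha>" .
    have "y powr (-(\<beta> - \<alpha>)) \<le> y powr 0"
      using that assms by (intro powr_mono) auto
    then have 2: "0 \<le> 1 - y powr (-(\<beta> - \<alpha>))"
      using assms by simp
    have "y powr (-\<alpha>) \<le> y powr 0"
      using that assms by (intro powr_mono) auto
    then have 3: "y powr (-\<alpha>) \<le> 1"
      using assms by simp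
    have "y powr (-\<alpha>) - y powr (-\<beta>) = y powr (-\<alpha>) * (1 - y powr (-(\<beta> - \<alpha>)))"
      using assms by (simp add: algebra_simps powr_add[symmetric])
    then have "\<bar>y powr (-\<alpha>) - y powr (-\<beta>)\<bar> = y powr (-\<alpha>) * (1 - y powr (-(\<beta> - \<alpha>)))"
      using 2 by (simp add: abs_mult)
    also have "\<dots> \<le> 1 * (1 - y powr (-(\<beta> - \<alpha>)))"
      using 2 3 by (intro mult_right_mono)
    finally show ?thesis
      using 1 by simp
  qed
  show ?thesis
    using aux[of \<alpha> \<beta>] aux[of \<beta> \<alpha>] assms by (cases "\<alpha> \<le> \<beta>") auto
qed

lemma unit_law_tight:
  assumes "\<And>n. unit_law (\<rho> n)"
  shows "tight \<rho>"
  unfolding tight_def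
proof (intro conjI allI impI)
  show rd: "real_distribution (\<rho> n)" for n
    using assms by (simp add: unit_law_def)
  fix \<epsilon> :: real assume "0 < \<epsilon>"
  \<comment> \<open>Tightness is stated with half-open intervals; the left end \<open>-1\<close>
    keeps a possible atom at \<open>0\<close> inside.\<close>
  have "measure (\<rho> n) {-1<..1} = 1" for n
  proof -
    interpret real_distribution "\<rho> n" by (rule rd)
    have "AE u in \<rho> n. u \<in> {0..1}"
      using assms by (simp add: unit_law_def)
    then have "AE u in \<rho> n. u \<in> {-1<..1}"
      by eventually_elim auto
    then show ?thesis
      by (subst prob_eq_1) auto
  qed
  with \<open>0 < \<epsilon>\<close> show "\<exists>a b::real. a < b \<and> (\<forall>n. 1 - \<epsilon> < measure (\<rho> n) {a<..b})"
    by (intro exI[of _ "-1"] exI[of _ 1]) auto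
qed

text \<open>The limit law is pushed forward under the retraction of the line onto \<open>[0, 1]\<close>, which saves
  showing that it is concentrated there.\<close>

lemma unit_rep_limit:
  assumes rep: "\<And>n. unit_rep (\<alpha> n) (\<rho> n) (F n)"
    and \<alpha>: "\<And>n. 0 \<le> \<alpha> n" "\<alpha> \<longlonglongrightarrow> \<beta>"
    and F: "\<And>n x. x \<in> {0..1} \<Longrightarrow> 0 \<le> F n x" "\<And>x. x \<in> {0..1} \<Longrightarrow> (\<lambda>n. F n x) \<longlonglongrightarrow> G x"
  obtains \<sigma> where "unit_rep \<beta> \<sigma> G"
proof -
  have law: "unit_law (\<rho> n)" and rd: "real_distribution (\<rho> n)" and AE: "AE u in \<rho> n. u \<in> {0..1}" for n
    using rep[of n] by (auto simp: unit_rep_def unit_law_def)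
  obtain r M where r: "strict_mono (r :: nat \<Rightarrow> nat)" and M: "real_distribution M"
    and conv: "weak_conv_m (\<rho> \<circ> id \<circ> r) M"
    using tight_imp_convergent_subsubsequence[OF unit_law_tight[of \<rho>, OF law] strict_mono_id] by (elim exE conjE)
  interpret M: real_distribution M by fact
  define cl :: "real \<Rightarrow> real" where "cl u = max 0 (min 1 u)" for u
  have cl01: "cl u \<in> {0..1}" for u
    by (auto simp: cl_def)
  have cl_id: "cl u = u" if "u \<in> {0..1}" for u
    using that by (auto simp: cl_def)
  have [measurable]: "cl \<in> borel_measurable borel"
    unfolding cl_def[abs_def] by measurable
  have \<beta>: "0 \<le> \<beta>"
    using \<alpha> by (intro LIMSEQ_le_const) auto
  define \<sigma> where "\<sigma> = distr M borel cl"
  have "unit_law \<sigma>"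
    using cl01 by (auto simp: unit_law_def \<sigma>_def AE_distr_iff simp del: atLeastAtMost_iff intro!: M.real_distribution_distr)
  moreover have "(\<integral>\<^sup>+u. ennreal ((1 + x * u) powr (-\<beta>)) \<partial>\<sigma>) = ennreal (G x)" if x: "x \<in> {0..1}" for x
  proof -
    \<comment> \<open>Composing with \<open>cl\<close> extends the kernel to a bounded continuous
      function on the whole line, a valid test function for weak convergence.\<close>
    define h where "h b u = (1 + x * cl u) powr (-b)" for b u
    have y: "1 + x * cl u \<in> {1..2}" for u
      using x cl01[of u] by (auto simp: mult_le_one)
    have h_nonneg: "0 \<le> h b u" for b u
      by (simp add: h_def)
    have h_le: "h b u \<le> 1" if "0 \<le> b" for b u
      using powr_mono[of "-b" 0 "1 + x * cl u"] y[of u] that by (auto simp: h_def)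
    have [measurable]: "h b \<in> borel_measurable borel" for b
      unfolding h_def[abs_def] by measurable
    have int: "integrable L (h b)" if "real_distribution L" "0 \<le> b" for L b
    proof -
      interpret L: real_distribution L by fact
      show ?thesis
        using h_nonneg h_le[OF that(2)] by (intro L.integrable_const_bound[where B=1]) auto
    qed
    have F_eq: "F n x = (\<integral>u. h (\<alpha> n) u \<partial>\<rho> n)" for n
    proof -
      have "ennreal (F n x) = (\<integral>\<^sup>+u. ennreal ((1 + x * u) powr (-\<alpha> n)) \<partial>\<rho> n)"
        using rep[of n] x by (simp add: unit_rep_def)
      also have "\<dots> = (\<integral>\<^sup>+u. ennreal (h (\<alpha> n) u) \<partial>\<rho> n)"
        using AE[of n] by (intro nn_integral_cong_AE, eventually_elim) (simp add: h_def cl_id)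
      also have "\<dots> = ennreal (\<integral>u. h (\<alpha> n) u \<partial>\<rho> n)"
        using int[OF rd \<alpha>(1)] h_nonneg by (intro nn_integral_eq_integral) auto
      finally show ?thesis
        using F(1)[OF x, of n] h_nonneg by simp
    qed
    have "isCont (h \<beta>) u" for u
      unfolding h_def cl_def using y[of u] by (intro continuous_intros) (auto simp: cl_def)
    then have lim1: "(\<lambda>n. \<integral>u. h \<beta> u \<partial>(\<rho> \<circ> id \<circ> r) n) \<longlonglongrightarrow> (\<integral>u. h \<beta> u \<partial>M)"
      using h_nonneg h_le[OF \<beta>]
      by (intro weak_conv_imp_integral_bdd_continuous_conv[OF _ M conv, of _ 1]) (auto intro: rd)
    \<comment> \<open>Weak convergence treats a fixed integrand only. The change of order from
      \<open>\<alpha> n\<close> to \<open>\<beta>\<close> is therefore estimated separately,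
      uniformly over the laws.\<close>
    have "norm ((\<integral>u. h \<beta> u \<partial>\<rho> n) - F n x) \<le> \<bar>\<alpha> n - \<beta>\<bar>" for n
    proof -
      interpret L: real_distribution "\<rho> n" by (rule rd)
      have "(\<integral>u. h \<beta> u \<partial>\<rho> n) - F n x = (\<integral>u. h \<beta> u - h (\<alpha> n) u \<partial>\<rho> n)"
        unfolding F_eq using int[OF rd \<beta>] int[OF rd \<alpha>(1)] by (subst Bochner_Integration.integral_diff) auto
      also have "norm \<dots> \<le> (\<integral>u. norm (h \<beta> u - h (\<alpha> n) u) \<partial>\<rho> n)"
        by (rule integral_norm_bound)
      also have "\<dots> \<le> (\<integral>u. \<bar>\<alpha> n - \<beta>\<bar> \<partial>\<rho> n)"
      proof (rule integral_mono)
        show "integrable (\<rho> n) (\<lambda>u. norm (h \<beta> u - h (\<alpha> n) u))"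
          by (intro integrable_norm Bochner_Integration.integrable_diff int rd \<beta> \<alpha>(1))
        show "norm (h \<beta> u - h (\<alpha> n) u) \<le> \<bar>\<alpha> n - \<beta>\<bar>" for u
          using abs_powr_diff_le[OF y \<beta> \<alpha>(1), of u n] by (simp add: h_def abs_minus_commute)
      qed simp
      also have "\<dots> = \<bar>\<alpha> n - \<beta>\<bar>"
        using L.prob_space by simp
      finally show ?thesis by simp
    qed
    moreover have "(\<lambda>n. \<bar>\<alpha> n - \<beta>\<bar>) \<longlonglongrightarrow> 0"
      using \<alpha>(2) by (intro tendsto_rabs_zero LIM_zero)
    ultimately have "(\<lambda>n. (\<integral>u. h \<beta> u \<partial>\<rho> n) - F n x) \<longlonglongrightarrow> 0"
      by (rule Lim_null_comparison[OF always_eventually[OF allI]])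
    from tendsto_add[OF this F(2)[OF x]] have "(\<lambda>n. \<integral>u. h \<beta> u \<partial>\<rho> n) \<longlonglongrightarrow> G x"
      by simp
    from LIMSEQ_subseq_LIMSEQ[OF this r] have "(\<lambda>n. \<integral>u. h \<beta> u \<partial>(\<rho> \<circ> id \<circ> r) n) \<longlonglongrightarrow> G x"
      by (simp add: o_def)
    with lim1 have h_eq: "(\<integral>u. h \<beta> u \<partial>M) = G x"
      by (rule LIMSEQ_unique)
    have "(\<integral>\<^sup>+u. ennreal ((1 + x * u) powr (-\<beta>)) \<partial>\<sigma>) = (\<integral>\<^sup>+u. ennreal (h \<beta> u) \<partial>M)"
      unfolding \<sigma>_def h_def by (subst nn_integral_distr) auto
    also have "\<dots> = ennreal (\<integral>u. h \<beta> u \<partial>M)"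
      using int[OF M \<beta>] h_nonneg by (intro nn_integral_eq_integral) auto
    finally show ?thesis
      by (simp add: h_eq)
  qed
  ultimately show thesis
    by (intro that[of \<sigma>]) (simp add: unit_rep_def)
qed

text \<open>Each further factor of order \<open>\<alpha>\<close> costs one mixture. Starting from
  one factor keeps all orders positive, as the Beta law requires.\<close>

lemma unit_rep_powr:
  assumes "0 < \<alpha>" and rep: "unit_rep \<alpha> \<rho> (\<lambda>x. F x powr \<alpha>)"
  shows "\<exists>\<sigma>. unit_rep (real (Suc k) * \<alpha>) \<sigma> (\<lambda>x. F x powr (real (Suc k) * \<alpha>))"
proof (induction k)
  case 0
  then show ?case using rep by auto
next
  case (Suc k)
  then obtain \<sigma> where "unit_rep (real (Suc k) * \<alpha>) \<sigma> (\<lambda>x. F x powr (real (Suc k) * \<alpha>))"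
    by blast
  from unit_rep_mix[OF \<open>0 < \<alpha>\<close> _ rep this] \<open>0 < \<alpha>\<close>
  have "unit_rep (\<alpha> + real (Suc k) * \<alpha>) (mix \<alpha> (real (Suc k) * \<alpha>) \<rho> \<sigma>) (\<lambda>x. F x powr (\<alpha> + real (Suc k) * \<alpha>))"
    by (simp add: powr_add)
  then show ?case
    by (auto simp: algebra_simps)
qed

section \<open>Powers of a Stieltjes function\<close>

lemma Stieltjes_class_unit_rep:
  assumes \<alpha>: "0 < \<alpha>" and f: "Stieltjes_class \<alpha> (\<lambda>z. f z powr \<alpha>)" and pos: "0 < f 1" "\<And>z. 1 \<le> z \<Longrightarrow> 0 \<le> f z"
  obtains \<rho> where "unit_rep \<alpha> \<rho> (\<lambda>x. (f (1 + x) / f 1) powr \<alpha>)"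
proof -
  obtain a \<mu> where a: "0 \<le> a" and \<mu>: "M_plus \<alpha> \<mu>" and eq: "\<And>z. 0 < z \<Longrightarrow> f z powr \<alpha> = a + S_transform \<alpha> \<mu> z"
    using f by (auto simp: Stieltjes_class_def)
  obtain \<rho> where \<rho>: "unit_rep \<alpha> \<rho> (\<lambda>x. (a + S_transform \<alpha> \<mu> (1 + x)) / f 1 powr \<alpha>)"
    by (rule compactify[OF \<alpha> a \<mu> eq[OF zero_less_one]]) (use pos in auto)
  have "(a + S_transform \<alpha> \<mu> (1 + x)) / f 1 powr \<alpha> = (f (1 + x) / f 1) powr \<alpha>" if "x \<in> {0..1}" for x
    using eq[of "1 + x"] pos that by (simp add: powr_divide)
  with \<rho> show thesis
    by (intro that[of \<rho>]) (auto simp: unit_rep_def)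
qed

text \<open>The set lies in the image of \<open>N \<inter> {0..}\<close> under
  \<open>1 / (1 + t)\<close>, and differentiable maps send negligible sets to negligible sets. It
  carries Lebesgue-null sets from the variable \<open>t\<close> to the variable
  \<open>u\<close>.\<close>

lemma null_sets_reciprocal_preimage:
  assumes "N \<in> null_sets lborel"
  shows "{u::real. u \<in> {0<..1} \<and> 1 / u - 1 \<in> N} \<in> null_sets lborel"
proof -
  have [measurable]: "N \<in> sets borel"
    using assms by auto
  define U where "U = {u::real. u \<in> {0<..1} \<and> 1 / u - 1 \<in> N}"
  have "negligible (N \<inter> {0..})"
    using assms null_sets_completionI[of N lborel] by (intro negligible_Int) (auto simp: negligible_iff_null_sets)
  moreover have "(\<lambda>t. 1 / (1 + t)) differentiable_on (N \<inter> {0..})"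
    unfolding differentiable_on_def
  proof
    fix x assume "x \<in> N \<inter> {0..}"
    then have "((\<lambda>t. 1 / (1 + t)) has_real_derivative - 1 / (1 + x)\<^sup>2) (at x within N \<inter> {0..})"
      by (auto intro!: derivative_eq_intros simp: power2_eq_square)
    then show "(\<lambda>t. 1 / (1 + t)) differentiable at x within N \<inter> {0..}"
      by (auto simp: has_field_derivative_def intro: differentiableI)
  qed
  ultimately have "negligible ((\<lambda>t. 1 / (1 + t)) ` (N \<inter> {0..}))"
    by (intro negligible_differentiable_image_negligible) auto
  moreover have "U \<subseteq> (\<lambda>t. 1 / (1 + t)) ` (N \<inter> {0..})"
    by (auto simp: U_def field_simps intro!: image_eqI[of _ _ "1 / _ - 1"])
  ultimately have "U \<in> null_sets lebesgue"
    using negligible_subset negligible_iff_null_sets by blast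
  moreover have "U \<in> sets lborel"
    unfolding U_def by measurable
  ultimately show ?thesis
    unfolding U_def by (simp add: null_sets_completion_iff)
qed

theorem theorem6p5:
  fixes f :: "real \<Rightarrow> real" and a :: real and \<mu> :: "real measure"
  assumes a_nonneg: "a \<ge> 0"
    and mu: "M_plus 1 \<mu>"
    and rep: "\<forall>z>0. f z = a + S_transform 1 \<mu> z"
    and cases: "nonzero_singular_continuous_part \<mu> \<or>
                (purely_discrete \<mu> \<and> (\<exists>s t. s \<noteq> t \<and> s \<in> atoms \<mu> \<and> t \<in> atoms \<mu>))"
  shows "\<forall>n::nat. n \<ge> 2 \<longrightarrow>
           (\<exists>\<epsilon>. 0 < \<epsilon> \<and> \<epsilon> < 1 / real n \<and>
              (\<forall>\<alpha>. \<bar>\<alpha> - 1 / real n\<bar> < \<epsilon> \<longrightarrow>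
                   \<not> Stieltjes_class \<alpha> (\<lambda>z. f z powr \<alpha>)))
           \<and> \<not> Stieltjes_class (1 / real n) (\<lambda>z. f z powr (1 / real n))"
proof -
  have [measurable_cong, simp]: "sets \<mu> = sets borel"
    using mu by (auto simp: M_plus_def measure_on_Rplus_def)
  have f_nonneg: "0 \<le> f z" if "1 \<le> z" for z
    using rep that a_nonneg by (simp add: S_transform_def)
  note AE_nonneg = AE_nonneg_M_plus[OF mu]
  \<comment> \<open>If \<open>f 1\<close> were \<open>0\<close>, the positive kernel would force
    \<open>\<mu>\<close> to vanish, leaving neither a singular continuous part nor atoms.\<close>
  have "0 < f 1"
  proof (rule ccontr)
    assume "\<not> 0 < f 1"
    then have "S_transform 1 \<mu> 1 = 0"
      using rep a_nonneg by (auto simp: S_transform_def not_less intro!: antisym)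
    then have "(\<integral>\<^sup>+t. ennreal ((1 + t) powr (-1)) \<partial>\<mu>) = 0"
      using nn_integral_S_transform[OF _ mu, of 1] by simp
    then have "AE t in \<mu>. ennreal ((1 + t) powr (-1)) = 0"
      by (subst (asm) nn_integral_0_iff_AE) auto
    with AE_nonneg have "AE t in \<mu>. False"
      by eventually_elim (auto simp: ennreal_eq_0_iff)
    then have null: "A \<in> null_sets \<mu>" if "A \<in> sets borel" for A
      using that by (subst AE_iff_null_sets) auto
    have "emeasure \<mu> {t} = 0" for t
      using null[of "{t}"] by auto
    then have "atoms \<mu> = {}"
      by (auto simp: atoms_def)
    moreover have "null_sets (continuous_part \<mu>) = sets borel" if "atoms \<mu> = {}"
      using null that by (auto simp: continuous_part_def null_sets_def emeasure_density nn_integral_0_iff_AE AE_iff_null_sets)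
    ultimately show False
      using cases by (auto simp: nonzero_singular_continuous_part_def absolutely_continuous_def)
  qed

  \<comment> \<open>The representing law of the normalised function at order one, and its
    atoms\<close>
  define F where "F x = f (1 + x) / f 1" for x
  obtain \<tau> where \<tau>: "unit_rep 1 \<tau> F" and int_\<tau>: "\<And>g :: real \<Rightarrow> ennreal. g \<in> borel_measurable borel \<Longrightarrow>
      (\<integral>\<^sup>+u. g u \<partial>\<tau>) = (\<integral>\<^sup>+t. ennreal ((1 + t) powr (-1) / f 1) * g (1 / (1 + t)) \<partial>\<mu>) + ennreal (a / f 1) * g 0"
  proof -
    have f1: "f 1 = a + S_transform 1 \<mu> 1"
      using rep by simp
    obtain \<tau> where "unit_rep 1 \<tau> (\<lambda>x. (a + S_transform 1 \<mu> (1 + x)) / f 1)" and "\<And>g :: real \<Rightarrow> ennreal. g \<in> borel_measurable borel \<Longrightarrow>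
      (\<integral>\<^sup>+u. g u \<partial>\<tau>) = (\<integral>\<^sup>+t. ennreal ((1 + t) powr (-1) / f 1) * g (1 / (1 + t)) \<partial>\<mu>) + ennreal (a / f 1) * g 0"
      by (rule compactify[OF zero_less_one a_nonneg mu f1 \<open>0 < f 1\<close>]) blast
    moreover have "F x = (a + S_transform 1 \<mu> (1 + x)) / f 1" if "x \<in> {0..1}" for x
      using rep that by (simp add: F_def)
    ultimately show thesis
      by (intro that) (auto simp: unit_rep_def)
  qed
  interpret t: real_distribution \<tau>
    using \<tau> by (simp add: unit_rep_def unit_law_def)
  \<comment> \<open>The weight \<open>(1 + t) powr (-1) / f 1\<close> is strictly positive for
    \<open>t \<ge> 0\<close>, so no mass of \<open>\<mu>\<close> disappears in the passage to
    \<open>\<tau>\<close>.\<close>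
  have \<tau>_pos: "0 < emeasure \<tau> N" if [measurable]: "N \<in> sets borel" "A \<in> sets borel"
      and A: "\<And>t. 0 \<le> t \<Longrightarrow> t \<in> A \<Longrightarrow> 1 / (1 + t) \<in> N" "emeasure \<mu> A \<noteq> 0" for N A
  proof (rule ccontr)
    assume "\<not> 0 < emeasure \<tau> N"
    then have "(\<integral>\<^sup>+u. indicator N u \<partial>\<tau>) = 0"
      by (simp add: zero_less_iff_neq_zero)
    then have "(\<integral>\<^sup>+t. ennreal ((1 + t) powr (-1) / f 1) * indicator N (1 / (1 + t)) \<partial>\<mu>) = 0"
      by (subst (asm) int_\<tau>) auto
    then have "AE t in \<mu>. ennreal ((1 + t) powr (-1) / f 1) * indicator N (1 / (1 + t)) = 0"
      by (subst (asm) nn_integral_0_iff_AE) auto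
    with AE_nonneg have "AE t in \<mu>. t \<notin> A"
    proof eventually_elim
      case (elim t)
      then have "0 < (1 + t) powr (-1) / f 1"
        using \<open>0 < f 1\<close> by simp
      then show ?case
        using elim A(1)[of t] by (auto simp: ennreal_eq_0_iff)
    qed
    then have "A \<in> null_sets \<mu>"
      by (subst AE_iff_null_sets) auto
    with A(2) show False by auto
  qed
  \<comment> \<open>Only \<open>u > 0\<close> can be traced back to \<open>\<mu>\<close>: an atom of
    \<open>\<tau>\<close> at \<open>0\<close> comes from the constant \<open>a\<close>.\<close>
  have atom_\<mu>: "1 / u - 1 \<in> atoms \<mu>" if u: "0 < u" and pos: "0 < emeasure \<tau> {u}" for u
  proof (rule ccontr)
    assume "1 / u - 1 \<notin> atoms \<mu>"
    then have "{1 / u - 1} \<in> null_sets \<mu>"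
      by (auto simp: atoms_def null_sets_def zero_less_iff_neq_zero)
    then have "AE t in \<mu>. t \<noteq> 1 / u - 1"
      using AE_not_in by fastforce
    have "emeasure \<tau> {u} = (\<integral>\<^sup>+v. indicator {u} v \<partial>\<tau>)"
      by simp
    also have "\<dots> = (\<integral>\<^sup>+t. ennreal ((1 + t) powr (-1) / f 1) * indicator {u} (1 / (1 + t)) \<partial>\<mu>)"
      using u by (subst int_\<tau>) auto
    also have "\<dots> = (\<integral>\<^sup>+t. 0 \<partial>\<mu>)"
      using AE_nonneg \<open>AE t in \<mu>. t \<noteq> 1 / u - 1\<close>
    proof (intro nn_integral_cong_AE, eventually_elim)
      case (elim t)
      then have "1 / (1 + t) \<noteq> u"
        by auto
      then show ?case
        by simp
    qed
    finally show False
      using pos by simp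
  qed
  have atoms_nonneg: "0 \<le> t" if "t \<in> atoms \<mu>" for t
  proof (rule ccontr)
    assume "\<not> 0 \<le> t"
    then have "emeasure \<mu> {t} \<le> emeasure \<mu> {..<0}"
      by (intro emeasure_mono) auto
    with that mu show False
      by (auto simp: atoms_def M_plus_def measure_on_Rplus_def)
  qed
  have atom_\<tau>: "0 < emeasure \<tau> {1 / (1 + t)}" if "t \<in> atoms \<mu>" for t
    using that by (intro \<tau>_pos[of _ "{t}"]) (auto simp: atoms_def)
  \<comment> \<open>The total mass of \<open>\<mu>\<close> may be infinite, so countability is
    borrowed from the probability law \<open>\<tau>\<close> along the injection
    \<open>1 / (1 + t)\<close>.\<close>
  have "countable (atoms \<mu>)"
  proof -
    have "(\<lambda>t. 1 / (1 + t)) ` atoms \<mu> \<subseteq> {u. 0 < emeasure \<tau> {u}}"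
      using atom_\<tau> by auto
    then have "countable ((\<lambda>t. 1 / (1 + t)) ` atoms \<mu>)"
      using t.countable_atoms countable_subset by blast
    moreover have "inj_on (\<lambda>t. 1 / (1 + t)) (atoms \<mu>)"
      by (auto simp: inj_on_def dest!: atoms_nonneg)
    ultimately show ?thesis
      by (rule countable_image_inj_on)
  qed
  then have [measurable]: "atoms \<mu> \<in> sets borel"
    using countable_imp_null_set_lborel[of "atoms \<mu>"] by auto
  \<comment> \<open>In the first case \<open>\<tau>\<close> charges a Lebesgue null set free of
    atoms, in the second it has two atoms but lives on a countable set. A mixture can do
    neither.\<close>
  have not_mix: False
    if ab: "0 < \<alpha>" "0 < \<beta>" and rd: "real_distribution \<rho>" "real_distribution \<sigma>" and eq: "\<tau> = mix \<alpha> \<beta> \<rho> \<sigma>" for \<alpha> \<beta> \<rho> \<sigma>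
    using cases
  proof
    assume "nonzero_singular_continuous_part \<mu>"
    then obtain N where N: "N \<in> null_sets lborel" and "N \<notin> null_sets (continuous_part \<mu>)"
      by (auto simp: nonzero_singular_continuous_part_def absolutely_continuous_def)
    then have [measurable]: "N \<in> sets borel" and *: "emeasure (continuous_part \<mu>) N \<noteq> 0"
      by (auto simp: null_sets_def continuous_part_def)
    have "emeasure (continuous_part \<mu>) N = (\<integral>\<^sup>+t. indicator (UNIV - atoms \<mu>) t * indicator N t \<partial>\<mu>)"
      unfolding continuous_part_def by (subst emeasure_density) auto
    also have "\<dots> = (\<integral>\<^sup>+t. indicator (N - atoms \<mu>) t \<partial>\<mu>)"
      by (intro nn_integral_cong) (auto simp: indicator_def)
    finally have "emeasure \<mu> (N - atoms \<mu>) \<noteq> 0"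
      using * by simp
    \<comment> \<open>The counterpart in \<open>u\<close> of the part of \<open>N\<close> outside
      the atoms. Leaving out \<open>u = 0\<close> avoids the atom produced by \<open>a\<close>, so
      an atom of \<open>\<tau>\<close> in \<open>U\<close> would be one of \<open>\<mu>\<close>
      outside \<open>atoms \<mu>\<close>.\<close>
    define U where "U = {u. u \<in> {0<..1} \<and> 1 / u - 1 \<in> N - atoms \<mu>}"
    have "N - atoms \<mu> \<in> null_sets lborel"
      using N by (intro null_sets_subset[OF N]) auto
    then have U: "U \<in> null_sets lborel"
      unfolding U_def by (rule null_sets_reciprocal_preimage)
    then have "0 < emeasure \<tau> U"
      using \<open>emeasure \<mu> (N - atoms \<mu>) \<noteq> 0\<close> by (intro \<tau>_pos[of _ "N - atoms \<mu>"]) (auto simp: U_def)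
    then obtain u where "u \<in> U" "0 < emeasure \<tau> {u}"
      using mix_no_singular_continuous_part[OF ab rd U] unfolding eq by force
    then show False
      using atom_\<mu>[of u] by (auto simp: U_def)
  next
    assume "purely_discrete \<mu> \<and> (\<exists>s t. s \<noteq> t \<and> s \<in> atoms \<mu> \<and> t \<in> atoms \<mu>)"
    then obtain s t where discrete: "emeasure \<mu> (UNIV - atoms \<mu>) = 0" and st: "s \<noteq> t" "s \<in> atoms \<mu>" "t \<in> atoms \<mu>"
      by (auto simp: purely_discrete_def)
    \<comment> \<open>The images of the atoms together with \<open>0\<close>, which accounts for the
      constant \<open>a\<close>: this countable set carries all of \<open>\<tau>\<close>.\<close>
    define C where "C = insert 0 ((\<lambda>t. 1 / (1 + t)) ` atoms \<mu>)"
    have "0 \<in> C" "countable C"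
      using \<open>countable (atoms \<mu>)\<close> by (simp_all add: C_def)
    have [measurable]: "C \<in> sets borel"
      using countable_imp_null_set_lborel[OF \<open>countable C\<close>] by auto
    have "1 / (1 + s) \<noteq> 1 / (1 + t)"
      using st atoms_nonneg[of s] atoms_nonneg[of t] by auto
    with st have "0 < emeasure \<tau> (- C)"
      using mix_two_atoms[OF ab rd _ _ _ \<open>countable C\<close>] atom_\<tau> unfolding eq by blast
    have "UNIV - atoms \<mu> \<in> null_sets \<mu>"
      using discrete by (auto simp: null_sets_def)
    then have AE_atoms: "AE t in \<mu>. t \<in> atoms \<mu>"
      using AE_not_in by fastforce
    have "emeasure \<tau> (- C) = (\<integral>\<^sup>+u. indicator (- C) u \<partial>\<tau>)"
      by simp
    also have "\<dots> = (\<integral>\<^sup>+t. ennreal ((1 + t) powr (-1) / f 1) * indicator (- C) (1 / (1 + t)) \<partial>\<mu>)"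
      using \<open>0 \<in> C\<close> by (subst int_\<tau>) auto
    also have "\<dots> = (\<integral>\<^sup>+t. 0 \<partial>\<mu>)"
      using AE_atoms by (intro nn_integral_cong_AE, eventually_elim) (auto simp: C_def)
    finally show False
      using \<open>0 < emeasure \<tau> (- C)\<close> by simp
  qed
  have no_rep: False if n: "n \<ge> 2" and rep_n: "unit_rep (1 / real n) \<rho> (\<lambda>x. F x powr (1 / real n))" for n \<rho>
  proof -
    \<comment> \<open>Then \<open>Suc m\<close> is \<open>n - 1\<close>, at least \<open>1\<close>,
      the number of factors left once one factor of order \<open>1 / n\<close> is split off.\<close>
    obtain m where m: "n = Suc (Suc m)"
      using n by (metis add_2_eq_Suc le_Suc_ex)
    have pos: "0 < 1 / real n"
      using n by simp
    obtain \<sigma> where \<sigma>: "unit_rep (real (Suc m) * (1 / real n)) \<sigma> (\<lambda>x. F x powr (real (Suc m) * (1 / real n)))"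
      using unit_rep_powr[OF pos rep_n] by blast
    have pos': "0 < real (Suc m) * (1 / real n)"
      using n by simp
    have one: "1 / real n + real (Suc m) * (1 / real n) = 1"
      by (simp add: m field_simps)
    from unit_rep_mix[OF pos pos' rep_n \<sigma>]
    have "unit_rep 1 (mix (1 / real n) (real (Suc m) * (1 / real n)) \<rho> \<sigma>) (\<lambda>x. F x powr 1)"
      unfolding one powr_add[symmetric] by simp
    moreover have "F x powr 1 = F x" if "x \<in> {0..1}" for x
      using f_nonneg[of "1 + x"] \<open>0 < f 1\<close> that by (simp add: F_def)
    ultimately have "unit_rep 1 (mix (1 / real n) (real (Suc m) * (1 / real n)) \<rho> \<sigma>) F"
      by (auto simp: unit_rep_def)
    with \<tau> have "\<tau> = mix (1 / real n) (real (Suc m) * (1 / real n)) \<rho> \<sigma>"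
      by (rule unit_rep_unique)
    with pos pos' show False
      using rep_n \<sigma> by (intro not_mix[of "1 / real n" "real (Suc m) * (1 / real n)" \<rho> \<sigma>]) (auto simp: unit_rep_def unit_law_def)
  qed

  \<comment> \<open>From the single order \<open>1 / n\<close> to a neighbourhood, by
    compactness\<close>
  have neighbourhood: "\<exists>\<epsilon>. 0 < \<epsilon> \<and> \<epsilon> < 1 / real n \<and>
      (\<forall>\<alpha>. \<bar>\<alpha> - 1 / real n\<bar> < \<epsilon> \<longrightarrow> \<not> Stieltjes_class \<alpha> (\<lambda>z. f z powr \<alpha>))" if n: "n \<ge> 2" for n :: nat
  proof (rule ccontr)
    \<comment> \<open>Radii tending to \<open>0\<close>; the shift by two keeps even the first one
      strictly below \<open>1 / n\<close>, so that each one is an admissible candidate and every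
      chosen order is positive.\<close>
    define \<epsilon> where "\<epsilon> k = 1 / real n * inverse (real (Suc (Suc k)))" for k
    have \<epsilon>: "0 < \<epsilon> k" "\<epsilon> k < 1 / real n" for k
    proof -
      have "0 < 1 / real n" "0 < inverse (real (Suc (Suc k)))" "inverse (real (Suc (Suc k))) < 1"
        using n by (auto simp: inverse_less_1_iff)
      then show "0 < \<epsilon> k" "\<epsilon> k < 1 / real n"
        using mult_strict_left_mono[of "inverse (real (Suc (Suc k)))" 1 "1 / real n"]
        unfolding \<epsilon>_def by (auto simp del: of_nat_Suc)
    qed
    assume "\<not> ?thesis"
    then have "\<exists>\<alpha>. \<bar>\<alpha> - 1 / real n\<bar> < \<epsilon> k \<and> Stieltjes_class \<alpha> (\<lambda>z. f z powr \<alpha>)" for k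
      using \<epsilon>[of k] by blast
    then obtain \<alpha> where \<alpha>: "\<And>k. \<bar>\<alpha> k - 1 / real n\<bar> < \<epsilon> k" "\<And>k. Stieltjes_class (\<alpha> k) (\<lambda>z. f z powr \<alpha> k)"
      by metis
    have \<alpha>_pos: "0 < \<alpha> k" for k
      using \<alpha>(1)[of k] \<epsilon>[of k] by linarith
    have "\<exists>\<rho>. unit_rep (\<alpha> k) \<rho> (\<lambda>x. F x powr \<alpha> k)" for k
      using Stieltjes_class_unit_rep[OF \<alpha>_pos \<alpha>(2) \<open>0 < f 1\<close> f_nonneg] unfolding F_def by metis
    then obtain \<rho> where \<rho>: "\<And>k. unit_rep (\<alpha> k) (\<rho> k) (\<lambda>x. F x powr \<alpha> k)"
      by metis
    have "\<epsilon> \<longlonglongrightarrow> 1 / real n * 0"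
      unfolding \<epsilon>_def[abs_def] by (rule tendsto_mult[OF tendsto_const LIMSEQ_Suc[OF LIMSEQ_inverse_real_of_nat]])
    then have "\<epsilon> \<longlonglongrightarrow> 0"
      by simp
    moreover have "norm (\<alpha> k - 1 / real n) \<le> \<epsilon> k" for k
      using \<alpha>(1)[of k] by simp
    ultimately have "(\<lambda>k. \<alpha> k - 1 / real n) \<longlonglongrightarrow> 0"
      by (rule Lim_null_comparison[OF always_eventually[OF allI], rotated])
    then have lim: "\<alpha> \<longlonglongrightarrow> 1 / real n"
      by (rule LIM_zero_cancel)
    have "\<exists>\<sigma>. unit_rep (1 / real n) \<sigma> (\<lambda>x. F x powr (1 / real n))"
    proof (rule unit_rep_limit[OF \<rho> less_imp_le[OF \<alpha>_pos] lim])
      \<comment> \<open>With a nonnegative base and a positive limiting exponent,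
        \<open>powr\<close> is continuous here even for a base equal to \<open>0\<close>.\<close>
      show "(\<lambda>k. F x powr \<alpha> k) \<longlonglongrightarrow> F x powr (1 / real n)" if "x \<in> {0..1}" for x
        using f_nonneg[of "1 + x"] \<open>0 < f 1\<close> that n lim
        by (intro tendsto_powr') (auto simp: F_def)
    qed auto
    with no_rep[OF n] show False by blast
  qed
  show ?thesis
  proof (intro allI impI conjI)
    fix n :: nat assume "n \<ge> 2"
    from neighbourhood[OF this] show *: "\<exists>\<epsilon>>0. \<epsilon> < 1 / real n \<and>
        (\<forall>\<alpha>. \<bar>\<alpha> - 1 / real n\<bar> < \<epsilon> \<longrightarrow> \<not> Stieltjes_class \<alpha> (\<lambda>z. f z powr \<alpha>))"
      by blast
    from * show "\<not> Stieltjes_class (1 / real n) (\<lambda>z. f z powr (1 / real n))"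
      by auto
  qed
qed

end
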